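(* Let $n\ge1$. The family consisting of $1$ and the elements $$\mathcal S(A:B),\qquad \emptyset\ne A\subseteq\{1,\dots,n\},\quad B\subseteq A,\quad \min A\notin B,$$ is a basis of $Q_n^!$.
   Context: Let $F$ be a field. Let $V$ be the $F$-vector space with basis $\{v(A): \emptyset\neq A\subseteq\{1,\dots,n\}\}$, and put $v(\emptyset)=0$. For $A\subseteq\{1,\dots,n\}$ and distinct $i,j\in A$ put $$\mathcal V(A:\{i,j\})=v(A)\bigl(v(A\setminus\{i\})-v(A\setminus\{j\})\bigr)+\bigl(v(A\setminus\{i\})-v(A\setminus\{j\})\bigr)v(A\setminus\{i,j\})-v(A\setminus\{i\})^2+v(A\setminus\{j\})^2 .$$ Let $\mathcal Q\subseteq V\otimes V$ be the span of all these elements, let $V^*$ be the dual space with dual basis $\{v^*(A)\}$, let $\mathcal Q^\perp\subseteq V^*\otimes V^*$ be the annihilator of $\mathcal Q$ under the pairing $\langle a\otimes b,f\otimes g\rangle=f(a)g(b)$, and let $Q_n^!=T(V^* )/\langle\mathcal Q^\perp\rangle$ (quotient by the two-sided ideal generated by $\mathcal Q^\perp$). Let $s(A)\in Q_n^!$ be the image of $v^*(A)$. For $B=\{b_1>\dots>b_k\}\subseteq A\subseteq\{1,\dots,n\}$, with $A\neq\emptyset$ and $\min A\notin B$ ($\min A$ is the smallest element of $A$), put $$\mathcal S(A:B)=s(A)\,s(A\setminus\{b_1\})\,s(A\setminus\{b_1,b_2\})\cdots s(A\setminus\{b_1,\dots,b_k\}).$$ *)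

theory Defs
  imports
    "Jordan_Normal_Form.VS_Connect"
    "HOL-Algebra.QuotRing"
    "HOL-Library.Poly_Mapping"
begin

text \<open>
  Words form the free monoid under concatenation, so that \<open>'x list \<Rightarrow>\<^sub>0 'a\<close> is the free
  associative algebra over \<open>'a\<close> on the letters \<open>'x\<close>, i.e. the tensor algebra of the vector
  space with basis \<open>'x\<close>; a word of length \<open>d\<close> is a basis tensor of degree \<open>d\<close>, and the product of
  two elements of degree 1 is their tensor product.
\<close>

instantiation list :: (type) monoid_add
begin
definition zero_list :: "'a list" where "zero_list = []"
definition plus_list :: "'a list \<Rightarrow> 'a list \<Rightarrow> 'a list" where "plus_list = (@)"
instance by standard (simp_all add: zero_list_def plus_list_def)
end

type_synonym 'a tensor = "nat set list \<Rightarrow>\<^sub>0 'a"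

definition letters :: "nat \<Rightarrow> nat set set" where
  "letters n = {A. A \<noteq> {} \<and> A \<subseteq> {1..n}}"

text \<open>
  Both \<open>T(V)\<close> and \<open>T(V\<^sup>*)\<close> are represented by this algebra: the letter \<open>A\<close> stands for the basis
  vector \<open>v(A)\<close> in the former and for the dual basis vector \<open>v\<^sup>*(A)\<close> in the latter.
\<close>

definition tensor_algebra :: "nat \<Rightarrow> ('a::field, 'a tensor) module" where
  "tensor_algebra n =
     \<lparr>carrier = {p. Poly_Mapping.keys p \<subseteq> lists (letters n)}, mult = (*), one = 1, zero = 0, add = (+),
      smult = (\<lambda>c p. Poly_Mapping.single 0 c * p)\<rparr>"

definition tensor_square :: "nat \<Rightarrow> 'a::field tensor set" where
  "tensor_square n = {p. Poly_Mapping.keys p \<subseteq> {[A, B] |A B. A \<in> letters n \<and> B \<in> letters n}}"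

definition v_gen :: "nat set \<Rightarrow> 'a::field tensor" where
  "v_gen A = (if A = {} then 0 else Poly_Mapping.single [A] 1)"

definition v_dual :: "nat set \<Rightarrow> 'a::field tensor" where
  "v_dual A = Poly_Mapping.single [A] 1"

definition relator :: "nat set \<Rightarrow> nat \<Rightarrow> nat \<Rightarrow> 'a::field tensor" where
  "relator A i j =
     v_gen A * (v_gen (A - {i}) - v_gen (A - {j})) + (v_gen (A - {i}) - v_gen (A - {j})) * v_gen (A - {i, j})
       - (v_gen (A - {i}))^2 + (v_gen (A - {j}))^2"

definition relation_space :: "nat \<Rightarrow> 'a::field tensor set" where
  "relation_space n =
     LinearCombinations.module.span class_ring (tensor_algebra n)
       {relator A i j |A i j. A \<subseteq> {1..n} \<and> i \<in> A \<and> j \<in> A \<and> i \<noteq> j}"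

text \<open>
  The bilinear pairing of \<open>T(V)\<close> with \<open>T(V\<^sup>*)\<close> for which the words in the \<open>v(A)\<close> and the words in the
  \<open>v\<^sup>*(A)\<close> are dual to each other. In degree 1 it evaluates a functional at a vector, and in degree 2
  it is \<open>\<langle>a \<otimes> b, f \<otimes> g\<rangle> = f(a) g(b)\<close>; see \<open>pairing_tensor\<close> below.
\<close>

definition pairing :: "'a::field tensor \<Rightarrow> 'a tensor \<Rightarrow> 'a" where
  "pairing x f = (\<Sum>w\<in>Poly_Mapping.keys x. Poly_Mapping.lookup x w * Poly_Mapping.lookup f w)"

definition annihilator :: "nat \<Rightarrow> 'a::field tensor set" where
  "annihilator n = {f \<in> tensor_square n. \<forall>q\<in>relation_space n. pairing q f = 0}"

definition dual_ideal :: "nat \<Rightarrow> 'a::field tensor set" where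
  "dual_ideal n = Idl\<^bsub>tensor_algebra n\<^esub> (annihilator n)"

text \<open>\<open>Q\<^sub>n\<^sup>!\<close>: the quotient ring, with the scalar multiplication induced on cosets.\<close>

definition dual_algebra :: "nat \<Rightarrow> ('a::field, 'a tensor set) module" where
  "dual_algebra n =
     ring.extend (tensor_algebra n Quot dual_ideal n)
       (module.fields
         (\<lambda>c X. \<Union>x\<in>X. dual_ideal n +>\<^bsub>tensor_algebra n\<^esub> (c \<odot>\<^bsub>tensor_algebra n\<^esub> x)))"

definition s_gen :: "nat \<Rightarrow> nat set \<Rightarrow> 'a::field tensor set" where
  "s_gen n A = dual_ideal n +>\<^bsub>tensor_algebra n\<^esub> v_dual A"

text \<open>
  The list \<open>bs\<close> enumerates \<open>B\<close> decreasingly, so the \<open>k\<close>-th factor, \<open>0 \<le> k \<le> card B\<close>, omits the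
  \<open>k\<close> largest elements of \<open>B\<close> from \<open>A\<close>.
\<close>

definition S_prod :: "nat \<Rightarrow> nat set \<Rightarrow> nat set \<Rightarrow> 'a::field tensor set" where
  "S_prod n A B =
     (let bs = rev (sorted_list_of_set B)
      in foldr (\<otimes>\<^bsub>dual_algebra n\<^esub>)
           (map (\<lambda>k. s_gen n (A - set (take k bs))) [0..<Suc (length bs)]) \<one>\<^bsub>dual_algebra n\<^esub>)"

definition index_pairs :: "nat \<Rightarrow> (nat set \<times> nat set) set" where
  "index_pairs n = {(A, B). A \<noteq> {} \<and> A \<subseteq> {1..n} \<and> B \<subseteq> A \<and> Min A \<notin> B}"


text \<open>The pairing behaves as described, and the structures above are rings and vector spaces.\<close>

lemma lookup_mult_two:
  fixes p q :: "'a::field tensor"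
  assumes "Poly_Mapping.keys p \<subseteq> {[A] |A. True}"
  shows "Poly_Mapping.lookup (p * q) [C, D] = Poly_Mapping.lookup p [C] * Poly_Mapping.lookup q [D]"
proof -
  have "Poly_Mapping.lookup p l * (\<Sum>r. Poly_Mapping.lookup q r when [C, D] = l + r) =
      (Poly_Mapping.lookup p l * Poly_Mapping.lookup q [D] when l = [C])" for l
  proof (cases "l \<in> Poly_Mapping.keys p")
    case True
    then obtain X where l: "l = [X]" using assms by auto
    have "(\<Sum>r. Poly_Mapping.lookup q r when [C, D] = l + r) =
        (\<Sum>r. (Poly_Mapping.lookup q r when X = C) when r = [D])"
      by (rule arg_cong[where f = Sum_any]) (auto simp: l plus_list_def when_def fun_eq_iff)
    then show ?thesis by (simp add: l when_def)
  qed (simp add: in_keys_iff when_def)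
  then show ?thesis by (simp add: lookup_mult)
qed

lemma pairing_v_gen_v_dual:
  "A \<noteq> {} \<Longrightarrow> pairing (v_gen A) (v_dual B :: 'a::field tensor) = (if A = B then 1 else 0)"
  by (auto simp: pairing_def v_gen_def v_dual_def lookup_single)

lemma pairing_superset:
  assumes "finite W" "Poly_Mapping.keys x \<subseteq> W"
  shows "pairing x f = (\<Sum>w\<in>W. Poly_Mapping.lookup x w * Poly_Mapping.lookup f w)"
  unfolding pairing_def
  by (rule sum.mono_neutral_left) (use assms in \<open>auto simp: in_keys_iff\<close>)

lemma pairing_tensor:
  fixes a b f g :: "'a::field tensor"
  assumes a: "Poly_Mapping.keys a \<subseteq> {[A] |A. True}" and b: "Poly_Mapping.keys b \<subseteq> {[A] |A. True}"
    and f: "Poly_Mapping.keys f \<subseteq> {[A] |A. True}"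
  shows "pairing (a * b) (f * g) = pairing a f * pairing b g"
proof -
  let ?K = "Poly_Mapping.keys a \<times> Poly_Mapping.keys b"
  have shape: "\<exists>C D. z = ([C], [D])" if "z \<in> ?K" for z
  proof -
    have "fst z \<in> {[A] |A. True}" "snd z \<in> {[A] |A. True}"
      using that subsetD[OF a, of "fst z"] subsetD[OF b, of "snd z"] by (simp_all add: mem_Times_iff)
    then show ?thesis by (cases z) simp
  qed
  have inj: "inj_on (\<lambda>(u, w). u + w) ?K"
  proof (rule inj_onI)
    fix z z' assume z: "z \<in> ?K" "z' \<in> ?K" and eq: "(\<lambda>(u, w). u + w) z = (\<lambda>(u, w). u + w) z'"
    obtain C D C' D' where "z = ([C], [D])" "z' = ([C'], [D'])"
      using shape[OF z(1)] shape[OF z(2)] by blast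
    then show "z = z'" using eq by (simp add: plus_list_def)
  qed
  have "Poly_Mapping.keys (a * b) \<subseteq> (\<lambda>(u, w). u + w) ` ?K"
    using keys_mult[of a b] by force
  then have "pairing (a * b) (f * g) = (\<Sum>w\<in>(\<lambda>(u, w). u + w) ` ?K.
      Poly_Mapping.lookup (a * b) w * Poly_Mapping.lookup (f * g) w)"
    by (intro pairing_superset) simp_all
  also have "\<dots> = (\<Sum>(u, w)\<in>?K. (Poly_Mapping.lookup a u * Poly_Mapping.lookup f u) *
      (Poly_Mapping.lookup b w * Poly_Mapping.lookup g w))"
    unfolding sum.reindex[OF inj]
  proof (rule sum.cong)
    fix z assume "z \<in> ?K"
    then obtain C D where z: "z = ([C], [D])" using shape by blast
    show "((\<lambda>w. Poly_Mapping.lookup (a * b) w * Poly_Mapping.lookup (f * g) w) \<circ> (\<lambda>(u, w). u + w)) z =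
      (case z of (u, w) \<Rightarrow> (Poly_Mapping.lookup a u * Poly_Mapping.lookup f u) *
      (Poly_Mapping.lookup b w * Poly_Mapping.lookup g w))"
      by (simp add: z plus_list_def lookup_mult_two[OF a] lookup_mult_two[OF f])
  qed simp
  also have "\<dots> = pairing a f * pairing b g"
    by (simp add: pairing_def sum_product sum.cartesian_product)
  finally show ?thesis .
qed

lemma keys_scalar_mult:
  "Poly_Mapping.keys (Poly_Mapping.single 0 c * p) \<subseteq> Poly_Mapping.keys (p :: 'a::field tensor)"
  using keys_mult[of "Poly_Mapping.single 0 c" p] by (auto split: if_splits)

lemma ring_tensor_algebra: "ring (tensor_algebra n :: ('a::field, 'a tensor) module)"
proof (rule ringI)
  show "abelian_group (tensor_algebra n :: ('a, 'a tensor) module)"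
  proof (rule abelian_groupI)
    fix x :: "'a tensor" assume "x \<in> carrier (tensor_algebra n)"
    then have "- x \<in> carrier (tensor_algebra n)"
      by (auto simp: tensor_algebra_def in_keys_iff subset_iff)
    then show "\<exists>y\<in>carrier (tensor_algebra n). y \<oplus>\<^bsub>tensor_algebra n\<^esub> x = \<zero>\<^bsub>tensor_algebra n\<^esub>"
      by (intro bexI[of _ "- x"]) (simp_all add: tensor_algebra_def)
  qed (use keys_add in \<open>fastforce simp: tensor_algebra_def ac_simps\<close>)+
  show "Group.monoid (tensor_algebra n :: ('a, 'a tensor) module)"
  proof (rule monoidI)
    fix x y :: "'a tensor"
    assume "x \<in> carrier (tensor_algebra n)" "y \<in> carrier (tensor_algebra n)"
    then show "x \<otimes>\<^bsub>tensor_algebra n\<^esub> y \<in> carrier (tensor_algebra n)"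
      using keys_mult[of x y] by (fastforce simp: tensor_algebra_def plus_list_def)
  qed (auto simp: tensor_algebra_def mult.assoc zero_list_def)
qed (auto simp: tensor_algebra_def algebra_simps)

lemma cring_class_ring: "cring (class_ring :: 'a::field ring)"
proof -
  interpret field "class_ring :: 'a ring" by (rule class_field)
  show ?thesis by unfold_locales
qed

lemma vectorspace_tensor_algebra:
  "vectorspace class_ring (tensor_algebra n :: ('a::field, 'a tensor) module)"
proof -
  interpret ring "tensor_algebra n :: ('a, 'a tensor) module" by (rule ring_tensor_algebra)
  have "Module.module class_ring (tensor_algebra n :: ('a, 'a tensor) module)"
  proof (rule moduleI)
    fix c :: 'a and x :: "'a tensor" assume "x \<in> carrier (tensor_algebra n)"
    then show "c \<odot>\<^bsub>tensor_algebra n\<^esub> x \<in> carrier (tensor_algebra n)"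
      using keys_scalar_mult[of c x] by (auto simp: tensor_algebra_def)
  qed (auto simp: tensor_algebra_def algebra_simps single_add mult_single
      simp flip: mult.assoc intro: cring_class_ring abelian_group_axioms[unfolded tensor_algebra_def])
  then show ?thesis by (simp add: vectorspace_def class_field)
qed

lemma ideal_dual_ideal: "ideal (dual_ideal n :: 'a::field tensor set) (tensor_algebra n)"
proof -
  interpret ring "tensor_algebra n :: ('a, 'a tensor) module" by (rule ring_tensor_algebra)
  show ?thesis
    unfolding dual_ideal_def
    by (rule genideal_ideal)
       (fastforce simp: annihilator_def tensor_square_def tensor_algebra_def)
qed

lemma ring_extend: "ring R \<Longrightarrow> ring (ring.extend R e)"
proof -
  assume "ring R"
  then interpret ring R .
  show ?thesis
  proof (rule ringI)
    show "abelian_group (ring.extend R e)"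
      by (rule abelian_groupI)
         (auto simp: ring.defs a_ac intro: bexI[where x = "\<ominus>\<^bsub>R\<^esub> x" for x] l_neg)
    show "Group.monoid (ring.extend R e)"
      by (rule monoidI) (auto simp: ring.defs m_assoc)
  qed (auto simp: ring.defs l_distr r_distr)
qed

lemma ring_dual_algebra: "ring (dual_algebra n :: ('a::field, 'a tensor set) module)"
  unfolding dual_algebra_def
  by (intro ring_extend ideal.quotient_is_ring ideal_dual_ideal)

lemma dual_algebra_simps:
  fixes n :: nat and x y :: "'a::field tensor"
  defines "T \<equiv> tensor_algebra n :: ('a, 'a tensor) module"
    and "I \<equiv> dual_ideal n :: 'a tensor set"
  shows "carrier (dual_algebra n :: ('a, 'a tensor set) module) = (\<lambda>x. I +>\<^bsub>T\<^esub> x) ` carrier T"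
    and "\<one>\<^bsub>dual_algebra n\<^esub> = I +>\<^bsub>T\<^esub> \<one>\<^bsub>T\<^esub>"
    and "\<lbrakk>x \<in> carrier T; y \<in> carrier T\<rbrakk> \<Longrightarrow>
      (I +>\<^bsub>T\<^esub> x) \<oplus>\<^bsub>dual_algebra n\<^esub> (I +>\<^bsub>T\<^esub> y) = I +>\<^bsub>T\<^esub> (x \<oplus>\<^bsub>T\<^esub> y)"
    and "\<lbrakk>x \<in> carrier T; y \<in> carrier T\<rbrakk> \<Longrightarrow>
      (I +>\<^bsub>T\<^esub> x) \<otimes>\<^bsub>dual_algebra n\<^esub> (I +>\<^bsub>T\<^esub> y) = I +>\<^bsub>T\<^esub> (x \<otimes>\<^bsub>T\<^esub> y)"
    and "x \<in> carrier T \<Longrightarrow> c \<odot>\<^bsub>dual_algebra n\<^esub> (I +>\<^bsub>T\<^esub> x) = I +>\<^bsub>T\<^esub> (c \<odot>\<^bsub>T\<^esub> x)"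
proof -
  interpret ideal I T unfolding I_def T_def by (rule ideal_dual_ideal)
  interpret V: vectorspace "class_ring :: 'a ring" T
    unfolding T_def by (rule vectorspace_tensor_algebra)
  note defs = dual_algebra_def FactRing_def ring.defs module.defs
    T_def[symmetric] I_def[symmetric]
  have smult_eq: "c \<odot>\<^bsub>dual_algebra n\<^esub> X = (\<Union>y\<in>X. I +>\<^bsub>T\<^esub> (c \<odot>\<^bsub>T\<^esub> y))"
    for c :: 'a and X :: "'a tensor set"
    by (simp only: defs module.select_convs)
  show "carrier (dual_algebra n :: ('a, 'a tensor set) module) = (\<lambda>x. I +>\<^bsub>T\<^esub> x) ` carrier T"
    by (auto simp: defs A_RCOSETS_def')
  show "\<one>\<^bsub>dual_algebra n\<^esub> = I +>\<^bsub>T\<^esub> \<one>\<^bsub>T\<^esub>"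
    by (simp add: defs)
  show "(I +>\<^bsub>T\<^esub> x) \<oplus>\<^bsub>dual_algebra n\<^esub> (I +>\<^bsub>T\<^esub> y) = I +>\<^bsub>T\<^esub> (x \<oplus>\<^bsub>T\<^esub> y)"
    if "x \<in> carrier T" "y \<in> carrier T"
    using that by (simp add: defs a_rcos_sum)
  show "(I +>\<^bsub>T\<^esub> x) \<otimes>\<^bsub>dual_algebra n\<^esub> (I +>\<^bsub>T\<^esub> y) = I +>\<^bsub>T\<^esub> (x \<otimes>\<^bsub>T\<^esub> y)"
    if "x \<in> carrier T" "y \<in> carrier T"
    using that by (simp add: defs rcoset_mult_add)
  show "c \<odot>\<^bsub>dual_algebra n\<^esub> (I +>\<^bsub>T\<^esub> x) = I +>\<^bsub>T\<^esub> (c \<odot>\<^bsub>T\<^esub> x)" if x: "x \<in> carrier T"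
  proof -
    have const: "I +>\<^bsub>T\<^esub> (c \<odot>\<^bsub>T\<^esub> y) = I +>\<^bsub>T\<^esub> (c \<odot>\<^bsub>T\<^esub> x)" if y: "y \<in> I +>\<^bsub>T\<^esub> x" for y
    proof -
      obtain h where h: "h \<in> I" "y = h \<oplus>\<^bsub>T\<^esub> x" using y by (auto simp: a_r_coset_def')
      have hT: "h \<in> carrier T" using h by (auto intro: a_Hcarr)
      have "Poly_Mapping.single 0 c \<in> carrier T"
        by (auto simp: T_def tensor_algebra_def zero_list_def)
      then have "c \<odot>\<^bsub>T\<^esub> h \<in> I"
        using I_l_closed[OF h(1)] by (auto simp: T_def tensor_algebra_def)
      moreover have "c \<odot>\<^bsub>T\<^esub> y = c \<odot>\<^bsub>T\<^esub> h \<oplus>\<^bsub>T\<^esub> c \<odot>\<^bsub>T\<^esub> x"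
        using h hT x by (simp add: V.smult_r_distr)
      ultimately have "c \<odot>\<^bsub>T\<^esub> y \<in> I +>\<^bsub>T\<^esub> (c \<odot>\<^bsub>T\<^esub> x)"
        by (auto simp: a_r_coset_def')
      then show ?thesis using x by (intro a_repr_independence[symmetric] a_subgroup) auto
    qed
    have "x \<in> I +>\<^bsub>T\<^esub> x" using x by (rule a_rcos_self)
    then have "(\<Union>y\<in>I +>\<^bsub>T\<^esub> x. I +>\<^bsub>T\<^esub> (c \<odot>\<^bsub>T\<^esub> y)) = I +>\<^bsub>T\<^esub> (c \<odot>\<^bsub>T\<^esub> x)"
      using const by (intro SUP_eq_const) (blast, assumption)
    then show ?thesis by (simp only: smult_eq)
  qed
qed

lemma vectorspace_dual_algebra:
  "vectorspace class_ring (dual_algebra n :: ('a::field, 'a tensor set) module)"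
proof -
  interpret Q: ring "dual_algebra n :: ('a, 'a tensor set) module" by (rule ring_dual_algebra)
  interpret V: vectorspace "class_ring :: 'a ring" "tensor_algebra n :: ('a, 'a tensor) module"
    by (rule vectorspace_tensor_algebra)
  have "Module.module class_ring (dual_algebra n :: ('a, 'a tensor set) module)"
    by (rule moduleI)
       (use V.smult_l_distr V.smult_r_distr V.smult_assoc1 V.smult_closed V.M.a_closed V.smult_one in
        \<open>auto simp: dual_algebra_simps intro: cring_class_ring Q.abelian_group_axioms\<close>)
  then show ?thesis by (simp add: vectorspace_def class_field)
qed

end

theory Submission
  imports Defs
begin

text \<open>
  Independence: \<open>T(V\<^sup>*)\<close> acts from the right on the exterior algebra with generators
  \<open>e\<^sub>1, \<dots>, e\<^sub>n\<close>. For a product \<open>X\<close> of generators and the set \<open>Y\<close> of the remaining indices,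
  \<open>s(Y - {i})\<close> sends \<open>X\<close> to \<open>X \<and> e\<^sub>i\<close>, \<open>s(Y)\<close> sends it to \<open>- (\<Sum>i\<in>Y. X \<and> e\<^sub>i)\<close>, and the other
  letters send it to 0. The coefficients by which a quadratic tensor \<open>f\<close> acts are, up to sign, its
  pairings with the relators, so the annihilator of the relations acts by 0 and the action descends
  to the quotient. The coefficient of \<open>X \<and> B \<and> e\<^sub>m\<close>, \<open>m = min A\<close>, in the image of the product
  \<open>X\<close> of the generators with index outside \<open>A\<close> separates \<open>S(A:B)\<close> from all other products
  \<open>S(A':B')\<close> except some with \<open>A' = A - {i}\<close>, which are dealt with by induction on the size of \<open>A\<close>.

  Spanning: in the quotient \<open>s(A) s(B) = 0\<close> unless \<open>B\<close> is \<open>A\<close> or \<open>A - {i}\<close>, and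
  \<open>s(A)\<^sup>2 = - (\<Sum>i\<in>A. s(A) s(A - {i}))\<close> if \<open>card A \<ge> 2\<close>, and
  \<open>s(A)\<^sup>2 = - (\<Sum>i\<notin>A. s(A \<union> {i}) s(A))\<close>. Multiplied by \<open>s(A \<union> {b, c})\<close>, the last relation
  shows that exchanging two successive removals changes the sign, and multiplied by
  \<open>s(A \<union> {b})\<close> that a square can be moved to the left end of a product. Hence a product in which
  \<open>min A\<close> is removed can be rewritten with \<open>min A\<close> removed last, where the second relation replaces
  it by other elements of \<open>A\<close> and by a square, which the third relation turns into products that
  start with a larger set.
\<close>

section \<open>Linear functionals on the tensor algebra\<close>

abbreviation word :: "nat set list \<Rightarrow> 'a::field tensor" where
  "word w \<equiv> Poly_Mapping.single w 1"

abbreviation scalar :: "'a::field \<Rightarrow> 'a tensor" where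
  "scalar c \<equiv> Poly_Mapping.single 0 c"

text \<open>The linear functional with value \<open>g w\<close> at each word \<open>w\<close>. It
  serves twice: with the coefficients of a tensor as \<open>g\<close> it is the pairing, and with
  \<open>matrix_coeff\<close> as \<open>g\<close> it gives an entry of the matrix by which
  \<open>p\<close> acts.\<close>

definition evaluation :: "(nat set list \<Rightarrow> 'a) \<Rightarrow> 'a::field tensor \<Rightarrow> 'a" where
  "evaluation g p = (\<Sum>w\<in>Poly_Mapping.keys p. Poly_Mapping.lookup p w * g w)"

lemma evaluation_superset:
  assumes "finite W" "Poly_Mapping.keys p \<subseteq> W"
  shows "evaluation g p = (\<Sum>w\<in>W. Poly_Mapping.lookup p w * g w)"
  unfolding evaluation_def
  by (rule sum.mono_neutral_left) (use assms in \<open>auto simp: in_keys_iff\<close>)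

lemma evaluation_add: "evaluation g (p + q) = evaluation g p + evaluation g q"
proof -
  let ?W = "Poly_Mapping.keys p \<union> Poly_Mapping.keys q"
  have "evaluation g r = (\<Sum>w\<in>?W. Poly_Mapping.lookup r w * g w)"
    if "Poly_Mapping.keys r \<subseteq> ?W" for r
    by (rule evaluation_superset) (use that in auto)
  then show ?thesis
    using keys_add[of p q] by (simp add: lookup_add distrib_right sum.distrib)
qed

lemma evaluation_zero [simp]: "evaluation g 0 = 0"
  by (simp add: evaluation_def)

lemma evaluation_single [simp]: "evaluation g (Poly_Mapping.single w c) = c * g w"
  by (simp add: evaluation_def)

lemma evaluation_uminus: "evaluation g (- p) = - evaluation g p"
  by (simp add: evaluation_def sum_negf keys_def)

lemma evaluation_diff: "evaluation g (p - q) = evaluation g p - evaluation g q"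
  using evaluation_add[of g p "- q"] by (simp add: evaluation_uminus)

lemma evaluation_sum: "evaluation g (\<Sum>i\<in>I. f i) = (\<Sum>i\<in>I. evaluation g (f i))"
  by (induction I rule: infinite_finite_induct) (simp_all add: evaluation_add)

lemma pairing_eq_evaluation: "pairing p f = evaluation (Poly_Mapping.lookup f) p"
  by (simp add: pairing_def evaluation_def)

lemma tensor_expansion:
  "(p :: 'a::field tensor) =
     (\<Sum>w\<in>Poly_Mapping.keys p. Poly_Mapping.single w (Poly_Mapping.lookup p w))"
  by (rule poly_mapping_eqI)
     (simp add: lookup_sum lookup_single when_def in_keys_iff)

lemma evaluation_mult:
  "evaluation g (p * q) = (\<Sum>u\<in>Poly_Mapping.keys p. \<Sum>w\<in>Poly_Mapping.keys q.
     Poly_Mapping.lookup p u * Poly_Mapping.lookup q w * g (u @ w))"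
proof -
  have "p * q = (\<Sum>u\<in>Poly_Mapping.keys p. \<Sum>w\<in>Poly_Mapping.keys q.
      Poly_Mapping.single (u @ w) (Poly_Mapping.lookup p u * Poly_Mapping.lookup q w))"
    using arg_cong2[OF tensor_expansion[of p] tensor_expansion[of q], where f = "(*)"]
    by (simp add: sum_product mult_single plus_list_def)
  then show ?thesis by (simp add: evaluation_sum)
qed

lemma word_mult: "word u * word w = (word (u @ w) :: 'a::field tensor)"
  by (simp add: mult_single plus_list_def)

lemma word_Nil: "word [] = (1 :: 'a::field tensor)"
  by (metis single_one zero_list_def)

lemma scalar_mult_word: "scalar c * word w = (Poly_Mapping.single w c :: 'a::field tensor)"
  by (simp add: mult_single)

lemma scalar_commute: "scalar c * p = p * (scalar c :: 'a::field tensor)"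
proof -
  have "scalar c * Poly_Mapping.single w d = Poly_Mapping.single w d * (scalar c :: 'a tensor)" for w d
    by (simp add: mult_single mult.commute)
  then show ?thesis
    by (subst (1 2) tensor_expansion[of p]) (simp add: sum_distrib_left sum_distrib_right)
qed

lemma tensor_algebra_simps [simp]:
  "carrier (tensor_algebra n) = {p :: 'a::field tensor. Poly_Mapping.keys p \<subseteq> lists (letters n)}"
  "x \<otimes>\<^bsub>tensor_algebra n\<^esub> y = x * y" "\<one>\<^bsub>tensor_algebra n\<^esub> = 1"
  "\<zero>\<^bsub>tensor_algebra n\<^esub> = 0" "x \<oplus>\<^bsub>tensor_algebra n\<^esub> y = x + y"
  "c \<odot>\<^bsub>tensor_algebra n\<^esub> x = scalar c * x"
  by (simp_all add: tensor_algebra_def)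

lemma a_inv_tensor_algebra [simp]:
  assumes "x \<in> carrier (tensor_algebra n)"
  shows "\<ominus>\<^bsub>tensor_algebra n\<^esub> x = - (x :: 'a::field tensor)"
proof -
  interpret ring "tensor_algebra n :: ('a, 'a tensor) module" by (rule ring_tensor_algebra)
  have "- x \<in> carrier (tensor_algebra n)"
    using assms by (simp add: keys_def)
  then show ?thesis using minus_equality[of "- x" x] assms by simp
qed

section \<open>The representation on the exterior algebra\<close>

text \<open>
  The subset \<open>X\<close> of \<open>{1..n}\<close> stands for the product in decreasing order of the generators
  \<open>e\<^sub>x\<close>, \<open>x \<in> X\<close>, so that \<open>wedge_sign X i\<close> is the sign of \<open>X \<and> e\<^sub>i\<close>. In
  \<open>matrix_coeff n X w Z\<close>, the coefficient of \<open>Z\<close> in the image of \<open>X\<close>, the leftmost letter of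
  \<open>w\<close> acts first.
\<close>

definition wedge_sign :: "nat set \<Rightarrow> nat \<Rightarrow> 'a::field" where
  "wedge_sign X i = (- 1) ^ card {x \<in> X. x < i}"

definition letter_coeff :: "nat \<Rightarrow> nat set \<Rightarrow> nat set \<Rightarrow> nat \<Rightarrow> 'a::field" where
  "letter_coeff n X A i = of_bool (A = {1..n} - X - {i}) - of_bool (A = {1..n} - X)"

fun matrix_coeff :: "nat \<Rightarrow> nat set \<Rightarrow> nat set list \<Rightarrow> nat set \<Rightarrow> 'a::field" where
  "matrix_coeff n X [] Z = of_bool (X = Z)"
| "matrix_coeff n X (A # w) Z =
     (\<Sum>i\<in>{1..n} - X. wedge_sign X i * letter_coeff n X A i * matrix_coeff n (insert i X) w Z)"

text \<open>For \<open>i < j\<close>, inserting \<open>i\<close> first adds one to the number of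
  elements below \<open>j\<close>, whereas inserting \<open>j\<close> first leaves the number below
  \<open>i\<close> unchanged. So exactly one of the signs flips.\<close>

lemma wedge_sign_anticommute:
  assumes "finite X" "i \<notin> X" "j \<notin> X" "i \<noteq> j"
  shows "wedge_sign X i * wedge_sign (insert i X) j =
    - (wedge_sign X j * wedge_sign (insert j X) i :: 'a::field)"
  using assms
proof (induction i j rule: linorder_wlog)
  case (le i j)
  then have "{x \<in> insert i X. x < j} = insert i {x \<in> X. x < j}"
    "{x \<in> insert j X. x < i} = {x \<in> X. x < i}" by auto
  with le show ?case by (simp add: wedge_sign_def)
next
  case (sym i j)
  then show ?case by (metis minus_minus)
qed

text \<open>Words act by products of matrices, with \<open>W\<close> running over the intermediate
  basis elements. The hypothesis places \<open>X\<close> itself in that range, as the empty word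
  requires.\<close>

lemma matrix_coeff_append:
  assumes "X \<subseteq> {1..n}"
  shows "matrix_coeff n X (u @ w) Z =
    (\<Sum>W\<in>Pow {1..n}. matrix_coeff n X u W * (matrix_coeff n W w Z :: 'a::field))"
  using assms
proof (induction u arbitrary: X)
  case Nil
  then show ?case by (simp add: of_bool_def if_distrib[of "\<lambda>x. x * _"] sum.delta' cong: if_cong)
next
  case (Cons A u)
  have "matrix_coeff n X ((A # u) @ w) Z = (\<Sum>i\<in>{1..n} - X. wedge_sign X i * letter_coeff n X A i *
      (\<Sum>W\<in>Pow {1..n}. matrix_coeff n (insert i X) u W * (matrix_coeff n W w Z :: 'a)))"
    using Cons by simp
  also have "\<dots> = (\<Sum>W\<in>Pow {1..n}. matrix_coeff n X (A # u) W * matrix_coeff n W w Z)"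
    by (simp add: sum_distrib_left sum_distrib_right mult.assoc) (rule sum.swap)
  finally show ?case .
qed

text \<open>The matrix product carries over to tensors by bilinearity. Hence the tensors that act by
  zero are closed under multiplication from either side.\<close>

lemma evaluation_matrix_coeff_mult:
  assumes "X \<subseteq> {1..n}"
  shows "evaluation (\<lambda>w. matrix_coeff n X w Z) (p * q) =
    (\<Sum>W\<in>Pow {1..n}. evaluation (\<lambda>w. matrix_coeff n X w W) p * evaluation (\<lambda>w. matrix_coeff n W w Z) q)"
proof -
  have "evaluation (\<lambda>w. matrix_coeff n X w Z) (p * q) =
      (\<Sum>u\<in>Poly_Mapping.keys p. \<Sum>w\<in>Poly_Mapping.keys q. \<Sum>W\<in>Pow {1..n}.
        (Poly_Mapping.lookup p u * matrix_coeff n X u W) * (Poly_Mapping.lookup q w * matrix_coeff n W w Z))"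
    by (simp add: evaluation_mult matrix_coeff_append[OF assms] sum_distrib_left mult_ac)
  also have "\<dots> = (\<Sum>u\<in>Poly_Mapping.keys p. \<Sum>W\<in>Pow {1..n}. \<Sum>w\<in>Poly_Mapping.keys q.
        (Poly_Mapping.lookup p u * matrix_coeff n X u W) * (Poly_Mapping.lookup q w * matrix_coeff n W w Z))"
    by (intro sum.cong refl sum.swap)
  also have "\<dots> = (\<Sum>W\<in>Pow {1..n}. \<Sum>u\<in>Poly_Mapping.keys p. \<Sum>w\<in>Poly_Mapping.keys q.
        (Poly_Mapping.lookup p u * matrix_coeff n X u W) * (Poly_Mapping.lookup q w * matrix_coeff n W w Z))"
    by (rule sum.swap)
  finally show ?thesis
    by (simp add: evaluation_def sum_product)
qed

section \<open>Coefficient conditions for the annihilator\<close>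

lemma lookup_tensor_square:
  assumes "f \<in> tensor_square n" "C = {} \<or> D = {}"
  shows "Poly_Mapping.lookup f [C, D] = 0"
  using assms by (auto simp: tensor_square_def letters_def in_keys_iff subset_iff)

lemma v_gen_mult:
  "v_gen C * v_gen D = (if C = {} \<or> D = {} then 0 else word [C, D] :: 'a::field tensor)"
  by (simp add: v_gen_def mult_single plus_list_def)

text \<open>The relator expands into six products of letters. Those containing the empty set need no
  separate treatment: \<open>v_gen {}\<close> is zero, and so are the coefficients of
  \<open>f\<close> there.\<close>

lemma pairing_relator:
  assumes "f \<in> tensor_square n"
  defines "F \<equiv> \<lambda>C D. Poly_Mapping.lookup f [C, D]"
  shows "pairing (relator A i j) f = F A (A - {i}) - F A (A - {j})
    + F (A - {i}) (A - {i, j}) - F (A - {j}) (A - {i, j}) - F (A - {i}) (A - {i}) + F (A - {j}) (A - {j})"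
proof -
  have "evaluation (Poly_Mapping.lookup f) (v_gen C * v_gen D) = F C D" for C D
    using lookup_tensor_square[OF assms(1), of C D] by (auto simp: v_gen_mult F_def)
  then show ?thesis
    by (simp add: pairing_eq_evaluation relator_def algebra_simps power2_eq_square
        evaluation_add evaluation_diff)
qed

lemma relator_closed:
  assumes "A \<subseteq> {1..n}"
  shows "relator A i j \<in> carrier (tensor_algebra n :: ('a::field, 'a tensor) module)"
proof -
  interpret T: ring "tensor_algebra n :: ('a, 'a tensor) module" by (rule ring_tensor_algebra)
  have *: "v_gen B \<in> carrier (tensor_algebra n :: ('a, 'a tensor) module)" if "B \<subseteq> A" for B
    using that assms by (auto simp: v_gen_def letters_def)
  have mult: "x * y \<in> carrier (tensor_algebra n)" and add: "x + y \<in> carrier (tensor_algebra n)"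
    if "x \<in> carrier (tensor_algebra n)" "y \<in> carrier (tensor_algebra n)" for x y :: "'a tensor"
    using T.m_closed[OF that] T.a_closed[OF that] by simp_all
  have diff: "x - y \<in> carrier (tensor_algebra n)"
    if "x \<in> carrier (tensor_algebra n)" "y \<in> carrier (tensor_algebra n)" for x y :: "'a tensor"
    using add[of x "- y"] that T.a_inv_closed[of y] by simp
  show ?thesis
    unfolding relator_def power2_eq_square by (intro mult add diff *) auto
qed

lemma relator_in_relation_space:
  assumes "A \<subseteq> {1..n}" "i \<in> A" "j \<in> A" "i \<noteq> j"
  shows "(relator A i j :: 'a::field tensor) \<in> relation_space n"
proof -
  interpret V: vectorspace "class_ring :: 'a ring" "tensor_algebra n :: ('a, 'a tensor) module"
    by (rule vectorspace_tensor_algebra)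
  have "{relator A i j |A i j. A \<subseteq> {1..n} \<and> i \<in> A \<and> j \<in> A \<and> i \<noteq> j} \<subseteq> V.span
      {relator A i j |A i j. A \<subseteq> {1..n} \<and> i \<in> A \<and> j \<in> A \<and> i \<noteq> j}"
    using relator_closed by (intro V.in_own_span) blast
  then show ?thesis using assms unfolding relation_space_def by blast
qed

text \<open>Pairing to zero with \<open>f\<close> is a linear condition, so it passes from the
  relators to their span.\<close>

lemma annihilatorI:
  fixes f :: "'a::field tensor"
  assumes f: "f \<in> tensor_square n"
    and zero: "\<And>A i j. A \<subseteq> {1..n} \<Longrightarrow> i \<in> A \<Longrightarrow> j \<in> A \<Longrightarrow> i \<noteq> j \<Longrightarrow> pairing (relator A i j) f = 0"
  shows "f \<in> annihilator n"
proof -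
  interpret V: vectorspace "class_ring :: 'a ring" "tensor_algebra n :: ('a, 'a tensor) module"
    by (rule vectorspace_tensor_algebra)
  let ?N = "{q \<in> carrier (tensor_algebra n). pairing q f = 0}"
  have ev_scalar: "evaluation g (scalar c * q) = c * evaluation g q" for g c and q :: "'a tensor"
    by (cases "c = 0")
       (simp_all add: evaluation_mult evaluation_def[of g q] zero_list_def sum_distrib_left mult_ac)
  have "LinearCombinations.submodule class_ring ?N (tensor_algebra n :: ('a, 'a tensor) module)"
  proof (rule LinearCombinations.submodule.intro)
    show "c \<odot>\<^bsub>tensor_algebra n\<^esub> x \<in> ?N" if "x \<in> ?N" for c x
      using that keys_scalar_mult[of c x] by (auto simp: pairing_eq_evaluation ev_scalar)
    show "x \<oplus>\<^bsub>tensor_algebra n\<^esub> y \<in> ?N" if "x \<in> ?N" "y \<in> ?N" for x y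
      using that V.a_closed[of x y] by (auto simp: pairing_eq_evaluation evaluation_add)
  qed (auto simp: pairing_eq_evaluation V.module_axioms)
  then have "V.span {relator A i j |A i j. A \<subseteq> {1..n} \<and> i \<in> A \<and> j \<in> A \<and> i \<noteq> j} \<subseteq> ?N"
    using relator_closed zero by (intro V.span_is_subset) blast+
  then show ?thesis
    using f by (auto simp: annihilator_def relation_space_def)
qed

text \<open>
  The coefficient of \<open>X \<and> e\<^sub>i \<and> e\<^sub>j\<close> in the image of \<open>X\<close> under \<open>f\<close> is, up to sign, the pairing of
  \<open>f\<close> with \<open>relator ({1..n} - X) i j\<close>.
\<close>

lemma evaluation_annihilator:
  fixes f :: "'a::field tensor"
  assumes f: "f \<in> annihilator n" and X: "X \<subseteq> {1..n}"
  shows "evaluation (\<lambda>w. matrix_coeff n X w Z) f = 0"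
proof -
  define Y where "Y = {1..n} - X"
  define F where "F = (\<lambda>C D. Poly_Mapping.lookup f [C, D])"
  \<comment> \<open>\<open>h i j\<close> is the weight, without the sign, with which
    \<open>f\<close> takes \<open>X\<close> to \<open>X \<and> e\<^sub>i \<and> e\<^sub>j\<close>.
    Its four terms correspond to the two choices of letter in each factor.\<close>
  define h where "h = (\<lambda>i j. F (Y - {i}) (Y - {i, j}) - F (Y - {i}) (Y - {i}) - F Y (Y - {i, j}) + F Y (Y - {i}))"
  define \<sigma> where "\<sigma> = (\<lambda>i j. wedge_sign X i * wedge_sign (insert i X) j * of_bool (insert j (insert i X) = Z) :: 'a)"
  \<comment> \<open>The empty set belongs to the range because \<open>Y - {i}\<close> and
    \<open>Y - {i, j}\<close> may be empty, and the sums over \<open>L\<close> below are evaluated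
    at these sets.\<close>
  define L where "L = Pow {1..n}"
  have fin: "finite L" "finite Y" by (simp_all add: L_def Y_def)
  have fsq: "f \<in> tensor_square n" using f by (simp add: annihilator_def)
  have compl: "{1..n} - X = Y" "{1..n} - insert i X = Y - {i}" for i by (auto simp: Y_def)
  \<comment> \<open>In \<open>h i j - h j i\<close> the terms at \<open>[Y, Y - {i, j}]\<close>
    cancel, and the rest is exactly the pairing with \<open>relator Y i j\<close>.\<close>
  have h_sym: "h i j = h j i" if "i \<in> Y" "j \<in> Y" "i \<noteq> j" for i j
  proof -
    have "pairing (relator Y i j) f = 0"
      using f relator_in_relation_space[of Y n i j] that by (auto simp: annihilator_def Y_def)
    then show ?thesis
      unfolding pairing_relator[OF fsq] h_def F_def by (simp add: insert_commute algebra_simps)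
  qed
  have \<sigma>_anti: "\<sigma> i j = - \<sigma> j i" if "i \<in> Y" "j \<in> Y" "i \<noteq> j" for i j
  proof -
    have "finite X" using X by (rule finite_subset) simp
    then show ?thesis
      using wedge_sign_anticommute[of X i j] that unfolding \<sigma>_def Y_def
      by (auto simp: insert_commute)
  qed
  have "Poly_Mapping.keys f \<subseteq> (\<lambda>(C, D). [C, D]) ` (L \<times> L)"
    using fsq by (fastforce simp: tensor_square_def letters_def L_def)
  then have "evaluation (\<lambda>w. matrix_coeff n X w Z) f =
      (\<Sum>w\<in>(\<lambda>(C, D). [C, D]) ` (L \<times> L). Poly_Mapping.lookup f w * matrix_coeff n X w Z)"
    by (intro evaluation_superset) (simp_all add: fin)
  also have "\<dots> = (\<Sum>C\<in>L. \<Sum>D\<in>L. F C D * matrix_coeff n X [C, D] Z)"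
    by (subst sum.reindex) (auto simp: inj_on_def sum.cartesian_product F_def intro!: sum.cong)
  also have "\<dots> = (\<Sum>C\<in>L. \<Sum>D\<in>L. \<Sum>i\<in>Y. \<Sum>j\<in>Y - {i}.
      \<sigma> i j * (F C D * letter_coeff n X C i * letter_coeff n (insert i X) D j))"
    by (simp add: compl[simplified] sum_distrib_left \<sigma>_def mult_ac)
  also have "\<dots> = (\<Sum>i\<in>Y. \<Sum>j\<in>Y - {i}. \<sigma> i j *
      (\<Sum>C\<in>L. \<Sum>D\<in>L. F C D * letter_coeff n X C i * letter_coeff n (insert i X) D j))"
  proof -
    have "(\<Sum>C\<in>L. \<Sum>D\<in>L. \<Sum>i\<in>Y. \<Sum>j\<in>Y - {i}. g C D i j) =
        (\<Sum>i\<in>Y. \<Sum>j\<in>Y - {i}. \<Sum>C\<in>L. \<Sum>D\<in>L. g C D i j)"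
      for g :: "nat set \<Rightarrow> nat set \<Rightarrow> nat \<Rightarrow> nat \<Rightarrow> 'a"
    proof -
      let ?S = "SIGMA i:Y. Y - {i}"
      have "(\<Sum>C\<in>L. \<Sum>D\<in>L. \<Sum>i\<in>Y. \<Sum>j\<in>Y - {i}. g C D i j) =
          (\<Sum>C\<in>L. \<Sum>D\<in>L. \<Sum>y\<in>?S. g C D (fst y) (snd y))"
        by (simp add: sum.Sigma fin split_def)
      also have "\<dots> = (\<Sum>C\<in>L. \<Sum>y\<in>?S. \<Sum>D\<in>L. g C D (fst y) (snd y))"
        by (intro sum.cong refl sum.swap)
      also have "\<dots> = (\<Sum>y\<in>?S. \<Sum>C\<in>L. \<Sum>D\<in>L. g C D (fst y) (snd y))"
        by (rule sum.swap)
      also have "\<dots> = (\<Sum>i\<in>Y. \<Sum>j\<in>Y - {i}. \<Sum>C\<in>L. \<Sum>D\<in>L. g C D i j)"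
        using sum.Sigma[of Y "\<lambda>i. Y - {i}" "\<lambda>i j. \<Sum>C\<in>L. \<Sum>D\<in>L. g C D i j"]
        by (simp add: fin split_def)
      finally show ?thesis .
    qed
    then show ?thesis by (simp add: sum_distrib_left)
  qed
  also have "\<dots> = (\<Sum>i\<in>Y. \<Sum>j\<in>Y - {i}. \<sigma> i j * h i j)"
  proof (intro sum.cong refl arg_cong2[where f = "(*)"])
    fix i j assume ij: "i \<in> Y" "j \<in> Y - {i}"
    have in_L: "B \<in> L" if "B \<subseteq> Y" for B using that by (auto simp: L_def Y_def)
    have delta: "(\<Sum>D\<in>L. g D * of_bool (D = B)) = g B" if "B \<subseteq> Y" for g :: "nat set \<Rightarrow> 'a" and B
      using in_L[OF that] fin by (simp add: of_bool_def if_distrib[of "\<lambda>x. _ * x"] sum.delta cong: if_cong)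
    have diff: "(\<Sum>D\<in>L. g D * (of_bool (D = B) - of_bool (D = B'))) = g B - g B'"
      if "B \<subseteq> Y" "B' \<subseteq> Y" for g :: "nat set \<Rightarrow> 'a" and B B'
      using that by (simp only: right_diff_distrib sum_subtractf delta)
    have "Y - {i} - {j} = Y - {i, j}" by auto
    then have "(\<Sum>C\<in>L. \<Sum>D\<in>L. F C D * letter_coeff n X C i * letter_coeff n (insert i X) D j) =
        (\<Sum>C\<in>L. (F C (Y - {i, j}) - F C (Y - {i})) * (of_bool (C = Y - {i}) - of_bool (C = Y)))"
      unfolding letter_coeff_def compl
      by (intro sum.cong refl, subst diff) (auto simp: left_diff_distrib)
    also have "\<dots> = h i j"
      by (subst diff) (auto simp: h_def)
    finally show "(\<Sum>C\<in>L. \<Sum>D\<in>L. F C D * letter_coeff n X C i * letter_coeff n (insert i X) D j) = h i j" .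
  qed
  \<comment> \<open>The sign is antisymmetric and the weight symmetric. Cancelling
    \<open>(j, i)\<close> against \<open>(i, j)\<close> works in every characteristic, while showing
    that the sum equals its own negative would not suffice in characteristic two.\<close>
  also have "\<dots> = (\<Sum>i\<in>Y. \<Sum>j\<in>{j \<in> Y. i < j}. \<sigma> i j * h i j) + (\<Sum>i\<in>Y. \<Sum>j\<in>{j \<in> Y. j < i}. \<sigma> i j * h i j)"
  proof -
    have "(\<Sum>j\<in>Y - {i}. \<sigma> i j * h i j) = (\<Sum>j\<in>{j \<in> Y. i < j}. \<sigma> i j * h i j) + (\<Sum>j\<in>{j \<in> Y. j < i}. \<sigma> i j * h i j)" for i
      by (subst sum.union_disjoint[symmetric]) (auto simp: fin intro!: sum.cong)
    then show ?thesis by (simp add: sum.distrib)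
  qed
  also have "(\<Sum>i\<in>Y. \<Sum>j\<in>{j \<in> Y. j < i}. \<sigma> i j * h i j) = (\<Sum>j\<in>Y. \<Sum>i\<in>{i \<in> Y. j < i}. \<sigma> i j * h i j)"
    by (rule sum.swap_restrict) (simp_all add: fin)
  also have "\<dots> = - (\<Sum>i\<in>Y. \<Sum>j\<in>{j \<in> Y. i < j}. \<sigma> i j * h i j)"
    unfolding sum_negf[symmetric]
  proof (intro sum.cong refl)
    fix i j assume "i \<in> Y" "j \<in> {j \<in> Y. i < j}"
    then show "\<sigma> j i * h j i = - (\<sigma> i j * h i j)"
      using \<sigma>_anti[of j i] h_sym[of j i] by simp
  qed
  finally show ?thesis by simp
qed

text \<open>The tensors with vanishing matrix coefficients form a two-sided ideal by
  \<open>evaluation_matrix_coeff_mult\<close>, and this ideal contains the annihilator.\<close>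

lemma evaluation_dual_ideal:
  fixes f :: "'a::field tensor"
  assumes f: "f \<in> dual_ideal n" and X: "X \<subseteq> {1..n}"
  shows "evaluation (\<lambda>w. matrix_coeff n X w Z) f = 0"
proof -
  interpret T: ring "tensor_algebra n :: ('a, 'a tensor) module" by (rule ring_tensor_algebra)
  let ?K = "{p \<in> carrier (tensor_algebra n :: ('a, 'a tensor) module).
    \<forall>X\<subseteq>{1..n}. \<forall>Z. evaluation (\<lambda>w. matrix_coeff n X w Z) p = 0}"
  have "ideal ?K (tensor_algebra n)"
  proof (rule idealI)
    show "subgroup ?K (add_monoid (tensor_algebra n :: ('a, 'a tensor) module))"
    proof (rule T.add.subgroupI)
      show "\<ominus>\<^bsub>tensor_algebra n\<^esub> x \<in> ?K" if "x \<in> ?K" for x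
        using that T.a_inv_closed[of x] by (auto simp: evaluation_uminus)
      show "x \<oplus>\<^bsub>tensor_algebra n\<^esub> y \<in> ?K" if "x \<in> ?K" "y \<in> ?K" for x y
        using that T.a_closed[of x y] by (auto simp: evaluation_add)
    qed (auto intro: exI[of _ 0])
    fix a x :: "'a tensor" assume ax: "a \<in> ?K" "x \<in> carrier (tensor_algebra n)"
    then show "x \<otimes>\<^bsub>tensor_algebra n\<^esub> a \<in> ?K" "a \<otimes>\<^bsub>tensor_algebra n\<^esub> x \<in> ?K"
      using T.m_closed[of x a] T.m_closed[of a x] by (auto simp: evaluation_matrix_coeff_mult)
  qed (rule T.ring_axioms)
  moreover have "annihilator n \<subseteq> ?K"
    using evaluation_annihilator
    by (auto simp: annihilator_def tensor_square_def)
  ultimately have "dual_ideal n \<subseteq> ?K"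
    unfolding dual_ideal_def by (rule T.genideal_minimal)
  then show ?thesis using f X by auto
qed

section \<open>Linear independence modulo the ideal\<close>

text \<open>The removals form a list because straightening passes through products in which they do
  not come in decreasing order.\<close>

fun chain :: "nat set \<Rightarrow> nat list \<Rightarrow> nat set list" where
  "chain A [] = [A]"
| "chain A (b # bs) = A # chain (A - {b}) bs"

abbreviation decreasing :: "nat set \<Rightarrow> nat list" where
  "decreasing B \<equiv> rev (sorted_list_of_set B)"

lemma wedge_sign_neq_0 [simp]: "wedge_sign X i \<noteq> 0"
  by (simp add: wedge_sign_def)

lemma chain_eq_Cons: "\<exists>w. chain A bs = A # w"
  by (cases bs) auto

lemma matrix_coeff_Cons_complement:
  "matrix_coeff n X (({1..n} - X) # w) Z =
    - (\<Sum>i\<in>{1..n} - X. wedge_sign X i * (matrix_coeff n (insert i X) w Z :: 'a::field))"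
proof -
  let ?Y = "{1..n} - X"
  have "letter_coeff n X ?Y k = (- 1 :: 'a)" if "k \<in> ?Y" for k
    using that unfolding letter_coeff_def by (auto simp: set_eq_iff)
  then show ?thesis
    unfolding matrix_coeff.simps sum_negf[symmetric] by (intro sum.cong refl) simp
qed

lemma matrix_coeff_Cons_neq_0D:
  assumes "matrix_coeff n X (A # w) Z \<noteq> 0"
  shows "A = {1..n} - X \<or> (\<exists>i\<in>{1..n} - X. A = {1..n} - X - {i})"
proof (rule ccontr)
  assume "\<not> ?thesis"
  then have "matrix_coeff n X (A # w) Z = 0"
    unfolding matrix_coeff.simps by (intro sum.neutral) (auto simp: letter_coeff_def)
  with assms show False by contradiction
qed

text \<open>The first letter adds some \<open>i\<close> to \<open>X\<close>. The next letter kills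
  the result unless \<open>i\<close> is the first removal \<open>b\<close>, and then that letter is
  again the complement. So the path is forced up to the last letter, which adds an arbitrary
  remaining \<open>k\<close>.\<close>

lemma matrix_coeff_chain_complement:
  assumes "distinct bs" "set bs \<subseteq> {1..n} - X"
  shows "(matrix_coeff n X (chain ({1..n} - X) bs) Z :: 'a::field) \<noteq> 0 \<longleftrightarrow>
    (\<exists>k\<in>{1..n} - X - set bs. Z = insert k (X \<union> set bs))"
  using assms
proof (induction bs arbitrary: X)
  case Nil
  \<comment> \<open>Different \<open>k\<close> give different sets \<open>insert k X\<close>, so no
    two summands can cancel.\<close>
  have *: "(\<Sum>i\<in>{1..n} - X. wedge_sign X i * of_bool (insert i X = Z)) = (wedge_sign X k :: 'a)"
    if k: "k \<in> {1..n} - X" "Z = insert k X" for k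
  proof -
    have "(\<Sum>i\<in>{1..n} - X. wedge_sign X i * of_bool (insert i X = Z)) =
        (\<Sum>i\<in>{1..n} - X. if i = k then wedge_sign X k else 0 :: 'a)"
      using k by (intro sum.cong) auto
    then show ?thesis using k(1) by simp
  qed
  have "(\<Sum>i\<in>{1..n} - X. wedge_sign X i * of_bool (insert i X = Z)) = (0 :: 'a)"
    if "\<not> (\<exists>k\<in>{1..n} - X. Z = insert k X)"
    using that by (intro sum.neutral) auto
  then have "(\<Sum>i\<in>{1..n} - X. wedge_sign X i * of_bool (insert i X = Z)) \<noteq> (0 :: 'a) \<longleftrightarrow>
      (\<exists>k\<in>{1..n} - X. Z = insert k X)"
    using * wedge_sign_neq_0 by metis
  then show ?case
    unfolding chain.simps matrix_coeff_Cons_complement matrix_coeff.simps(1) by simp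
next
  case (Cons b bs)
  let ?Y = "{1..n} - X"
  have b: "b \<in> ?Y" using Cons.prems by auto
  have *: "?Y - {b} = {1..n} - insert b X" by auto
  \<comment> \<open>The letter \<open>?Y - {b}\<close> contains \<open>i\<close>, but only subsets
    of the complement of \<open>insert i X\<close> act on \<open>insert i X\<close> by something
    nonzero.\<close>
  have zero: "(matrix_coeff n (insert i X) (chain (?Y - {b}) bs) Z :: 'a) = 0" if "i \<in> ?Y - {b}" for i
  proof (rule ccontr)
    obtain w where w: "chain (?Y - {b}) bs = (?Y - {b}) # w" using chain_eq_Cons by blast
    assume "\<not> ?thesis"
    then have "?Y - {b} \<subseteq> {1..n} - insert i X"
      using matrix_coeff_Cons_neq_0D[of n "insert i X" "?Y - {b}" w Z, where 'a = 'a] unfolding w by blast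
    with that show False by blast
  qed
  have "(\<Sum>i\<in>?Y. wedge_sign X i * (matrix_coeff n (insert i X) (chain (?Y - {b}) bs) Z :: 'a)) =
      wedge_sign X b * matrix_coeff n (insert b X) (chain (?Y - {b}) bs) Z"
    by (subst sum.remove[OF _ b]) (simp_all add: zero del: One_nat_def)
  moreover have "(matrix_coeff n (insert b X) (chain ({1..n} - insert b X) bs) Z :: 'a) \<noteq> 0 \<longleftrightarrow>
      (\<exists>k\<in>{1..n} - insert b X - set bs. Z = insert k (insert b X \<union> set bs))"
    using Cons.prems by (intro Cons.IH) auto
  moreover have "{1..n} - insert b X - set bs = ?Y - set (b # bs)"
    "insert b X \<union> set bs = X \<union> set (b # bs)" by auto
  ultimately show ?case
    unfolding chain.simps matrix_coeff_Cons_complement *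
    by (simp only: neg_equal_0_iff_equal mult_eq_0_iff wedge_sign_neq_0 simp_thms)
qed

lemma finite_index_pairs: "finite (index_pairs n)"
  by (rule finite_subset[of _ "Pow {1..n} \<times> Pow {1..n}"]) (auto simp: index_pairs_def)

lemma index_pairsD:
  assumes "(A, B) \<in> index_pairs n"
  shows "A \<noteq> {}" "A \<subseteq> {1..n}" "B \<subseteq> A" "Min A \<notin> B" "finite A" "finite B" "Min A \<in> A"
proof -
  show *: "A \<noteq> {}" "A \<subseteq> {1..n}" "B \<subseteq> A" "Min A \<notin> B" using assms by (auto simp: index_pairs_def)
  show fin: "finite A" by (rule finite_subset[OF *(2)]) simp
  show "finite B" by (rule finite_subset[OF *(3) fin])
  show "Min A \<in> A" using fin *(1) by (rule Min_in)
qed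

text \<open>Each matrix coefficient turns the membership into a linear equation for the
  coefficients. One equation is chosen for each index pair so that the system is triangular with
  respect to \<open>card A\<close>.\<close>

lemma chain_combination_in_dual_ideal:
  fixes c :: "nat set \<times> nat set \<Rightarrow> 'a::field"
  assumes "scalar c\<^sub>0 + (\<Sum>(A, B)\<in>index_pairs n. scalar (c (A, B)) * word (chain A (decreasing B)))
    \<in> dual_ideal n"
  shows "c\<^sub>0 = 0" "\<forall>z\<in>index_pairs n. c z = 0"
proof -
  have eq: "c\<^sub>0 * of_bool (X = Z) +
      (\<Sum>(A, B)\<in>index_pairs n. c (A, B) * matrix_coeff n X (chain A (decreasing B)) Z) = 0"
    if "X \<subseteq> {1..n}" for X Z
  proof -
    have "matrix_coeff n X 0 Z = (of_bool (X = Z) :: 'a)" by (simp add: zero_list_def)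
    then show ?thesis
      using evaluation_dual_ideal[OF assms that, of Z]
      by (simp add: evaluation_add evaluation_sum split_def scalar_mult_word)
  qed
  have c: "c (A, B) = 0" if "(A, B) \<in> index_pairs n" for A B
    using that
  proof (induction "card A" arbitrary: A B rule: less_induct)
    case less
    note AB = index_pairsD[OF less.prems]
    \<comment> \<open>\<open>X\<close> has complement \<open>A\<close>, so the chain of
      \<open>A\<close> follows a forced path. \<open>Z\<close> is the outcome in which the last
      index added is \<open>Min A\<close>; as \<open>Min A\<close> lies outside every admissible
      \<open>B\<close>, this outcome determines \<open>B\<close>.\<close>
    define X where "X = {1..n} - A"
    define Z where "Z = insert (Min A) (X \<union> B)"
    have Y: "{1..n} - X = A" using AB by (auto simp: X_def)
    \<comment> \<open>A product starting with another letter contributes only if that letter is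
      \<open>A - {i}\<close>, and then its coefficient vanishes by induction.\<close>
    have others: "c (A', B') * matrix_coeff n X (chain A' (decreasing B')) Z = 0"
      if index: "(A', B') \<in> index_pairs n" and neq: "(A', B') \<noteq> (A, B)" for A' B'
    proof (rule ccontr)
      note AB' = index_pairsD[OF index]
      obtain w where w: "chain A' (decreasing B') = A' # w" using chain_eq_Cons by blast
      assume nz: "\<not> ?thesis"
      then have "A' = A \<or> (\<exists>i\<in>A. A' = A - {i})"
        using matrix_coeff_Cons_neq_0D[of n X A' w Z, unfolded Y] unfolding w by (metis mult_zero_right)
      then show False
      proof
        assume [simp]: "A' = A"
        obtain k where k: "k \<in> A - B'" "Z = insert k (X \<union> B')"
          using matrix_coeff_chain_complement[of "decreasing B'" n X Z, where 'a = 'a, unfolded Y] nz AB'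
          by auto
        \<comment> \<open>Intersecting with \<open>A\<close> strips \<open>X\<close> from both
          descriptions of \<open>Z\<close>. Since \<open>Min A\<close> is not in \<open>B'\<close>,
          it must be \<open>k\<close>, and so \<open>B' = B\<close>.\<close>
        have "A \<inter> Z = insert k B'"
          using k(1) AB'(3) unfolding k(2) X_def by auto
        moreover have "A \<inter> Z = insert (Min A) B"
          using AB(3,7) unfolding Z_def X_def by blast
        ultimately have "insert k B' = insert (Min A) B" by simp
        moreover from this have "k = Min A" using AB' by auto
        ultimately have "B' = B" using AB(4) AB'(4) \<open>A' = A\<close> by (metis insert_ident)
        with neq show False by simp
      next
        assume "\<exists>i\<in>A. A' = A - {i}"
        then have "card A' < card A" using AB by (auto intro!: card_Diff1_less)
        then show False using less.hyps index nz by simp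
      qed
    qed
    have "X \<subseteq> {1..n}" by (auto simp: X_def)
    \<comment> \<open>The scalar term acts diagonally, so it contributes nothing to the entry at
      \<open>X\<close> and \<open>Z\<close>.\<close>
    moreover have "X \<noteq> Z" using AB(7) unfolding X_def Z_def by blast
    ultimately have "(\<Sum>z\<in>index_pairs n. case z of (A, B) \<Rightarrow>
        c (A, B) * matrix_coeff n X (chain A (decreasing B)) Z) = 0"
      using eq[of X Z] by simp
    moreover have "(\<Sum>z\<in>index_pairs n - {(A, B)}. case z of (A, B) \<Rightarrow>
        c (A, B) * matrix_coeff n X (chain A (decreasing B)) Z) = 0"
    proof (rule sum.neutral, rule ballI)
      fix z assume "z \<in> index_pairs n - {(A, B)}"
      then show "(case z of (A, B) \<Rightarrow> c (A, B) * matrix_coeff n X (chain A (decreasing B)) Z) = 0"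
        using others[of "fst z" "snd z"] by (cases z) simp
    qed
    ultimately have "c (A, B) * matrix_coeff n X (chain A (decreasing B)) Z = 0"
      using sum.remove[OF finite_index_pairs less.prems,
          of "\<lambda>(A, B). c (A, B) * matrix_coeff n X (chain A (decreasing B)) Z"] by simp
    moreover have "matrix_coeff n X (chain A (decreasing B)) Z \<noteq> (0 :: 'a)"
    proof (rule iffD2[OF matrix_coeff_chain_complement[of "decreasing B" n X, unfolded Y]])
      show "\<exists>k\<in>A - set (decreasing B). Z = insert k (X \<union> set (decreasing B))"
        using AB by (intro bexI[of _ "Min A"]) (simp_all add: Z_def)
    qed (use AB in simp_all)
    ultimately show ?case by simp
  qed
  then show "\<forall>z\<in>index_pairs n. c z = 0" by auto
  have "(\<Sum>(A, B)\<in>index_pairs n. c (A, B) * matrix_coeff n {} (chain A (decreasing B)) {}) = 0"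
    by (rule sum.neutral) (use c in auto)
  with eq[of "{}" "{}"] show "c\<^sub>0 = 0" by simp
qed

section \<open>The quadratic relations\<close>

context
  fixes n :: nat
begin

interpretation T: ring "tensor_algebra n :: ('a::field, 'a tensor) module"
  by (rule ring_tensor_algebra)

interpretation J: ideal "dual_ideal n :: 'a::field tensor set" "tensor_algebra n"
  by (rule ideal_dual_ideal)

lemma dual_ideal_zero: "(0 :: 'a::field tensor) \<in> dual_ideal n"
  using J.zero_closed by simp

lemma dual_ideal_add:
  "x \<in> dual_ideal n \<Longrightarrow> y \<in> dual_ideal n \<Longrightarrow> x + (y :: 'a::field tensor) \<in> dual_ideal n"
  using J.a_closed by simp

lemma dual_ideal_uminus: "x \<in> dual_ideal n \<Longrightarrow> - (x :: 'a::field tensor) \<in> dual_ideal n"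
  using J.a_inv_closed J.a_Hcarr by (metis a_inv_tensor_algebra)

lemma dual_ideal_diff:
  "x \<in> dual_ideal n \<Longrightarrow> y \<in> dual_ideal n \<Longrightarrow> x - (y :: 'a::field tensor) \<in> dual_ideal n"
  using dual_ideal_add[of x "- y"] dual_ideal_uminus[of y] by simp

lemma dual_ideal_sum:
  "(\<And>i. i \<in> I \<Longrightarrow> f i \<in> dual_ideal n) \<Longrightarrow> (\<Sum>i\<in>I. f i :: 'a::field tensor) \<in> dual_ideal n"
  by (induction I rule: infinite_finite_induct) (simp_all add: dual_ideal_zero dual_ideal_add)

lemma dual_ideal_mult_left:
  "x \<in> dual_ideal n \<Longrightarrow> w \<in> lists (letters n) \<Longrightarrow> word w * (x :: 'a::field tensor) \<in> dual_ideal n"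
  using J.I_l_closed[of x "word w"] by simp

lemma dual_ideal_mult_right:
  "x \<in> dual_ideal n \<Longrightarrow> w \<in> lists (letters n) \<Longrightarrow> (x :: 'a::field tensor) * word w \<in> dual_ideal n"
  using J.I_r_closed[of x "word w"] by simp

lemma annihilator_subset_dual_ideal: "(annihilator n :: 'a::field tensor set) \<subseteq> dual_ideal n"
  unfolding dual_ideal_def
  by (rule T.genideal_self) (auto simp: annihilator_def tensor_square_def)

end

lemma tensor_square_word: "A \<in> letters n \<Longrightarrow> B \<in> letters n \<Longrightarrow> word [A, B] \<in> tensor_square n"
  by (simp add: tensor_square_def)

lemma tensor_square_add: "x \<in> tensor_square n \<Longrightarrow> y \<in> tensor_square n \<Longrightarrow> x + y \<in> tensor_square n"
  using keys_add[of x y] by (auto simp: tensor_square_def)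

lemma tensor_square_sum:
  "(\<And>i. i \<in> I \<Longrightarrow> f i \<in> tensor_square n) \<Longrightarrow> (\<Sum>i\<in>I. f i) \<in> tensor_square n"
  by (induction I rule: infinite_finite_induct) (simp_all add: tensor_square_add, simp_all add: tensor_square_def)

lemma letters_finite: "A \<in> letters n \<Longrightarrow> finite A"
  by (auto simp: letters_def intro: finite_subset)

lemma letters_Diff: "A \<in> letters n \<Longrightarrow> A - B \<noteq> {} \<Longrightarrow> A - B \<in> letters n"
  by (auto simp: letters_def)

lemma letters_insert: "A \<in> letters n \<Longrightarrow> i \<in> {1..n} \<Longrightarrow> insert i A \<in> letters n"
  by (auto simp: letters_def)

text \<open>Injectivity excludes multiplicities, so that the coefficients of the sums of words below
  become membership tests.\<close>

lemma sum_of_bool_inj: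
  assumes "finite I" "inj_on h I"
  shows "(\<Sum>i\<in>I. of_bool (h i = y)) = (of_bool (y \<in> h ` I) :: 'b::semiring_1)"
proof (cases "y \<in> h ` I")
  case True
  then obtain k where k: "k \<in> I" "y = h k" by blast
  then have "(\<Sum>i\<in>I. of_bool (h i = y)) = (\<Sum>i\<in>I. if i = k then 1 else 0 :: 'b)"
    using assms by (intro sum.cong) (auto simp: inj_on_eq_iff)
  with k assms(1) True show ?thesis by simp
qed (auto intro!: sum.neutral)

text \<open>Every word occurring in a relator has the form \<open>[A, A]\<close> or
  \<open>[A, A - {i}]\<close> with \<open>i\<close> in \<open>A\<close>, so any other word pairs to
  zero with all relators.\<close>

lemma word_in_dual_ideal:
  assumes "C \<in> letters n" "D \<in> letters n" "D \<noteq> C" "\<And>i. i \<in> C \<Longrightarrow> D \<noteq> C - {i}"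
  shows "(word [C, D] :: 'a::field tensor) \<in> dual_ideal n"
proof (rule subsetD[OF annihilator_subset_dual_ideal], rule annihilatorI)
  show sq: "(word [C, D] :: 'a tensor) \<in> tensor_square n"
    using assms by (intro tensor_square_word)
  fix A i j assume A: "A \<subseteq> {1..n}" "i \<in> A" "j \<in> A" "i \<noteq> j"
  have "A - {i, j} = A - {i} - {j}" "A - {i, j} = A - {j} - {i}" by auto
  then have "[C, D] \<noteq> [A, A - {k}]" "[C, D] \<noteq> [A - {k}, A - {i, j}]" "[C, D] \<noteq> [A - {k}, A - {k}]"
    if "k = i \<or> k = j" for k
    using assms(3,4) A that by (auto; blast)+
  then have "Poly_Mapping.lookup (word [C, D]) [A, A - {k}] = (0 :: 'a)"
    "Poly_Mapping.lookup (word [C, D]) [A - {k}, A - {i, j}] = (0 :: 'a)"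
    "Poly_Mapping.lookup (word [C, D]) [A - {k}, A - {k}] = (0 :: 'a)" if "k = i \<or> k = j" for k
    using that unfolding lookup_single by simp_all
  then show "pairing (relator A i j) (word [C, D]) = (0 :: 'a)"
    unfolding pairing_relator[OF sq] by simp
qed

text \<open>\<open>relator B i j\<close> contains two of these words, with opposite signs, if
  \<open>A\<close> is \<open>B\<close>, \<open>B - {i}\<close> or \<open>B - {j}\<close>, and none
  otherwise. The second hypothesis excludes singletons, for which \<open>A - {i}\<close> would not
  be a letter.\<close>

lemma word_sum_remove_in_dual_ideal:
  assumes A: "A \<in> letters n" and ne: "\<And>i. i \<in> A \<Longrightarrow> A - {i} \<noteq> {}"
  shows "(word [A, A] + (\<Sum>i\<in>A. word [A, A - {i}]) :: 'a::field tensor) \<in> dual_ideal n" (is "?f \<in> _")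
proof (rule subsetD[OF annihilator_subset_dual_ideal], rule annihilatorI)
  show sq: "?f \<in> tensor_square n"
    using assms by (intro tensor_square_add tensor_square_sum tensor_square_word letters_Diff)
  have lookup: "Poly_Mapping.lookup ?f [C, D] =
      of_bool (C = A) * (of_bool (D = A) + of_bool (D \<in> (\<lambda>i. A - {i}) ` A))" for C D
  proof -
    have "inj_on (\<lambda>i. A - {i}) A" by (auto simp: inj_on_def)
    then show ?thesis
      using sum_of_bool_inj[OF letters_finite[OF A], of "\<lambda>i. A - {i}" D, where 'b = 'a]
      by (auto simp: lookup_add lookup_sum lookup_single when_def of_bool_def)
  qed
  fix B i j assume B: "B \<subseteq> {1..n}" "i \<in> B" "j \<in> B" "i \<noteq> j"
  have self: "A \<notin> (\<lambda>i. A - {i}) ` A" by auto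
  consider "B = A" | "B - {i} = A" | "B - {j} = A" | "B \<noteq> A" "B - {i} \<noteq> A" "B - {j} \<noteq> A" by blast
  then show "pairing (relator B i j) ?f = 0"
  proof cases
    case 1
    then have "B - {i} \<noteq> A" "B - {j} \<noteq> A" "B - {i} \<in> (\<lambda>i. A - {i}) ` A" "B - {j} \<in> (\<lambda>i. A - {i}) ` A"
      using B by auto
    with 1 show ?thesis unfolding pairing_relator[OF sq] lookup by simp
  next
    case 2
    then have "B \<noteq> A" "B - {j} \<noteq> A" "B - {i, j} \<noteq> A" "B - {i, j} \<in> (\<lambda>i. A - {i}) ` A"
      using B by auto
    with 2 self show ?thesis unfolding pairing_relator[OF sq] lookup by simp
  next
    case 3
    then have "B \<noteq> A" "B - {i} \<noteq> A" "B - {i, j} \<noteq> A" "B - {i, j} \<in> (\<lambda>i. A - {i}) ` A"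
      using B by auto
    with 3 self show ?thesis unfolding pairing_relator[OF sq] lookup by simp
  next
    case 4
    then show ?thesis unfolding pairing_relator[OF sq] lookup by simp
  qed
qed

text \<open>The same cancellation with the second letter fixed: \<open>relator B i j\<close>
  contains two of these words, with opposite signs, if \<open>A\<close> is \<open>B - {i}\<close>,
  \<open>B - {j}\<close> or \<open>B - {i, j}\<close>.\<close>

lemma word_sum_insert_in_dual_ideal:
  assumes A: "A \<in> letters n"
  shows "(word [A, A] + (\<Sum>i\<in>{1..n} - A. word [insert i A, A]) :: 'a::field tensor) \<in> dual_ideal n"
    (is "?f \<in> _")
proof (rule subsetD[OF annihilator_subset_dual_ideal], rule annihilatorI)
  show sq: "?f \<in> tensor_square n"
    using assms by (intro tensor_square_add tensor_square_sum tensor_square_word letters_insert) auto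
  let ?I = "(\<lambda>i. insert i A) ` ({1..n} - A)"
  have lookup: "Poly_Mapping.lookup ?f [C, D] = of_bool (D = A) * (of_bool (C = A) + of_bool (C \<in> ?I))" for C D
  proof -
    have "inj_on (\<lambda>i. insert i A) ({1..n} - A)" by (auto simp: inj_on_def)
    then show ?thesis
      using sum_of_bool_inj[of "{1..n} - A" "\<lambda>i. insert i A" C, where 'b = 'a]
      by (auto simp: lookup_add lookup_sum lookup_single when_def of_bool_def)
  qed
  fix B i j assume B: "B \<subseteq> {1..n}" "i \<in> B" "j \<in> B" "i \<noteq> j"
  have self: "A \<notin> ?I" by auto
  have inI: "C \<in> ?I" if "k \<in> B" "C = insert k A" "k \<notin> A" for k C using that B by auto
  consider "B - {i} = A" | "B - {j} = A" | "B - {i, j} = A"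
    | "B - {i} \<noteq> A" "B - {j} \<noteq> A" "B - {i, j} \<noteq> A" by blast
  then show "pairing (relator B i j) ?f = 0"
  proof cases
    case 1
    then have "B \<noteq> A" "B - {j} \<noteq> A" "B - {i, j} \<noteq> A" using B by auto
    moreover have "B \<in> ?I" using 1 B by (intro inI[of i]) auto
    ultimately show ?thesis using 1 self unfolding pairing_relator[OF sq] lookup by simp
  next
    case 2
    then have "B \<noteq> A" "B - {i} \<noteq> A" "B - {i, j} \<noteq> A" using B by auto
    moreover have "B \<in> ?I" using 2 B by (intro inI[of j]) auto
    ultimately show ?thesis using 2 self unfolding pairing_relator[OF sq] lookup by simp
  next
    case 3
    then have "B - {i} \<noteq> A" "B - {j} \<noteq> A" using B by auto
    moreover have "B - {i} \<in> ?I" using 3 B by (intro inI[of j]) auto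
    moreover have "B - {j} \<in> ?I" using 3 B by (intro inI[of i]) auto
    ultimately show ?thesis using 3 unfolding pairing_relator[OF sq] lookup by simp
  next
    case 4
    then show ?thesis unfolding pairing_relator[OF sq] lookup by simp
  qed
qed

section \<open>Straightening\<close>

text \<open>Straightening only has to place products in a span, so the signs produced by exchanges
  are not tracked.\<close>

definition eq_up_to_sign :: "nat \<Rightarrow> 'a::field tensor \<Rightarrow> 'a tensor \<Rightarrow> bool" where
  "eq_up_to_sign n x y \<longleftrightarrow> x - y \<in> dual_ideal n \<or> x + y \<in> dual_ideal n"

lemma eq_up_to_sign_refl: "eq_up_to_sign n x x"
  by (simp add: eq_up_to_sign_def dual_ideal_zero)

lemma eq_up_to_sign_trans:
  assumes "eq_up_to_sign n x y" "eq_up_to_sign n y z"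
  shows "eq_up_to_sign n x z"
proof -
  have "x - z = (x - y) + (y - z)" "x + z = (x - y) + (y + z)"
    "x + z = (x + y) - (y - z)" "x - z = (x + y) - (y + z)" by simp_all
  then show ?thesis
    using assms unfolding eq_up_to_sign_def by (metis dual_ideal_add dual_ideal_diff)
qed

lemma eq_up_to_sign_mult:
  assumes "eq_up_to_sign n x y" "u \<in> lists (letters n)" "w \<in> lists (letters n)"
  shows "eq_up_to_sign n (word u * x * word w) (word u * y * word w)"
proof -
  have "word u * x * word w - word u * y * word w = word u * (x - y) * word w"
    "word u * x * word w + word u * y * word w = word u * (x + y) * word w"
    by (simp_all add: algebra_simps)
  then show ?thesis
    using assms unfolding eq_up_to_sign_def
    by (auto intro: dual_ideal_mult_left dual_ideal_mult_right)
qed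

text \<open>Strictness of the inclusion keeps the last letter \<open>A - set bs\<close>
  nonempty.\<close>

lemma chain_in_lists:
  assumes "A \<subseteq> {1..n}" "distinct bs" "set bs \<subset> A"
  shows "chain A bs \<in> lists (letters n)"
  using assms
proof (induction bs arbitrary: A)
  case (Cons b bs)
  then have "chain (A - {b}) bs \<in> lists (letters n)" by (intro Cons.IH) auto
  with Cons.prems show ?case by (auto simp: letters_def)
qed (auto simp: letters_def)

lemma chain_snoc: "chain A (bs @ [b]) = chain A bs @ [A - set bs - {b}]"
proof (induction bs arbitrary: A)
  case (Cons c bs)
  have "A - {c} - set bs = A - set (c # bs)" by auto
  with Cons show ?case by simp
qed simp

lemma chain_last: "\<exists>ws. chain A bs = ws @ [A - set bs]"
proof (cases bs rule: rev_cases)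
  case (snoc cs c)
  moreover have "A - set cs - {c} = A - set (cs @ [c])" by auto
  ultimately show ?thesis by (auto simp: chain_snoc)
qed simp

text \<open>Multiply the insertion relation for \<open>A - {b}\<close> by \<open>A\<close> from the
  left. The summand for \<open>b\<close> is the first word; the other summands insert an element
  outside \<open>A\<close> and lie in the ideal by \<open>word_in_dual_ideal\<close>.\<close>

lemma word_square_shift:
  assumes "A \<in> letters n" "b \<in> A" "A - {b} \<noteq> {}"
  shows "(word [A, A, A - {b}] + word [A, A - {b}, A - {b}] :: 'a::field tensor) \<in> dual_ideal n"
proof -
  let ?D = "A - {b}"
  let ?I = "{1..n} - ?D"
  have D: "?D \<in> letters n" using assms by (intro letters_Diff)
  have b: "b \<in> ?I" using assms by (auto simp: letters_def)
  have "word [A] * (word [?D, ?D] + (\<Sum>i\<in>?I. word [insert i ?D, ?D])) \<in> (dual_ideal n :: 'a tensor set)"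
    using assms(1) D by (intro dual_ideal_mult_left word_sum_insert_in_dual_ideal) auto
  moreover have "(\<Sum>i\<in>?I - {b}. word [A, insert i ?D, ?D]) \<in> (dual_ideal n :: 'a tensor set)"
  proof (rule dual_ideal_sum)
    fix i assume "i \<in> ?I - {b}"
    then have "insert i ?D \<in> letters n" "i \<notin> A" using D by (auto intro!: letters_insert)
    then have "(word [A, insert i ?D] :: 'a tensor) \<in> dual_ideal n"
      using assms by (intro word_in_dual_ideal) auto
    then have "word [A, insert i ?D] * word [?D] \<in> (dual_ideal n :: 'a tensor set)"
      using D by (intro dual_ideal_mult_right) auto
    then show "word [A, insert i ?D, ?D] \<in> (dual_ideal n :: 'a tensor set)"
      by (simp add: word_mult)
  qed
  ultimately have "word [A] * (word [?D, ?D] + (\<Sum>i\<in>?I. word [insert i ?D, ?D]))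
      - (\<Sum>i\<in>?I - {b}. word [A, insert i ?D, ?D]) \<in> (dual_ideal n :: 'a tensor set)"
    by (rule dual_ideal_diff)
  moreover have "word [A] * (word [?D, ?D] + (\<Sum>i\<in>?I. word [insert i ?D, ?D]))
      - (\<Sum>i\<in>?I - {b}. word [A, insert i ?D, ?D]) = (word [A, A, ?D] + word [A, ?D, ?D] :: 'a tensor)"
  proof -
    have "word [A] * (word [?D, ?D] + (\<Sum>i\<in>?I. word [insert i ?D, ?D])) =
        (word [A, ?D, ?D] + (\<Sum>i\<in>?I. word [A, insert i ?D, ?D]) :: 'a tensor)"
      by (simp add: distrib_left sum_distrib_left word_mult)
    also have "(\<Sum>i\<in>?I. word [A, insert i ?D, ?D]) =
        (word [A, A, ?D] + (\<Sum>i\<in>?I - {b}. word [A, insert i ?D, ?D]) :: 'a tensor)"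
      using sum.remove[OF _ b, of "\<lambda>i. word [A, insert i ?D, ?D] :: 'a tensor"] assms(2)
      by (simp add: insert_absorb)
    finally show ?thesis by simp
  qed
  ultimately show ?thesis by simp
qed

text \<open>Multiply the insertion relation for \<open>A - {b, c}\<close> by \<open>A\<close> from
  the left. The square drops out because two elements are missing, and only inserting
  \<open>b\<close> or \<open>c\<close> gives a set that may follow \<open>A\<close>.\<close>

lemma word_swap:
  assumes "A \<in> letters n" "b \<in> A" "c \<in> A" "b \<noteq> c" "A - {b, c} \<noteq> {}"
  shows "(word [A, A - {b}, A - {b, c}] + word [A, A - {c}, A - {b, c}] :: 'a::field tensor) \<in> dual_ideal n"
proof -
  let ?D = "A - {b, c}"
  let ?I = "{1..n} - ?D"
  have D: "?D \<in> letters n" using assms by (intro letters_Diff)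
  have bc: "b \<in> ?I" "c \<in> ?I - {b}" using assms by (auto simp: letters_def)
  have "word [A] * (word [?D, ?D] + (\<Sum>i\<in>?I. word [insert i ?D, ?D])) \<in> (dual_ideal n :: 'a tensor set)"
    using assms(1) D by (intro dual_ideal_mult_left word_sum_insert_in_dual_ideal) auto
  moreover have zero: "word [A, E, ?D] \<in> (dual_ideal n :: 'a tensor set)"
    if "E \<in> letters n" "E \<noteq> A" "\<And>i. i \<in> A \<Longrightarrow> E \<noteq> A - {i}" for E
  proof -
    have "word [A, E] * word [?D] \<in> (dual_ideal n :: 'a tensor set)"
      using that D assms(1) by (intro dual_ideal_mult_right word_in_dual_ideal) auto
    then show ?thesis by (simp add: word_mult)
  qed
  have "word [A, ?D, ?D] \<in> (dual_ideal n :: 'a tensor set)"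
    using D assms by (intro zero) auto
  moreover have "(\<Sum>i\<in>?I - {b} - {c}. word [A, insert i ?D, ?D]) \<in> (dual_ideal n :: 'a tensor set)"
  proof (rule dual_ideal_sum)
    fix i assume i: "i \<in> ?I - {b} - {c}"
    then have "insert i ?D \<in> letters n" "i \<notin> A" using D by (auto intro!: letters_insert)
    then show "word [A, insert i ?D, ?D] \<in> (dual_ideal n :: 'a tensor set)"
      by (intro zero) auto
  qed
  ultimately have "word [A] * (word [?D, ?D] + (\<Sum>i\<in>?I. word [insert i ?D, ?D])) - (word [A, ?D, ?D]
      + (\<Sum>i\<in>?I - {b} - {c}. word [A, insert i ?D, ?D])) \<in> (dual_ideal n :: 'a tensor set)"
    by (intro dual_ideal_diff dual_ideal_add)
  moreover have "word [A] * (word [?D, ?D] + (\<Sum>i\<in>?I. word [insert i ?D, ?D])) - (word [A, ?D, ?D]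
      + (\<Sum>i\<in>?I - {b} - {c}. word [A, insert i ?D, ?D])) =
      (word [A, A - {b}, ?D] + word [A, A - {c}, ?D] :: 'a tensor)"
  proof -
    have "word [A] * (word [?D, ?D] + (\<Sum>i\<in>?I. word [insert i ?D, ?D])) =
        (word [A, ?D, ?D] + (\<Sum>i\<in>?I. word [A, insert i ?D, ?D]) :: 'a tensor)"
      by (simp add: distrib_left sum_distrib_left word_mult)
    also have "(\<Sum>i\<in>?I. word [A, insert i ?D, ?D]) =
        (word [A, insert b ?D, ?D] + (word [A, insert c ?D, ?D]
          + (\<Sum>i\<in>?I - {b} - {c}. word [A, insert i ?D, ?D])) :: 'a tensor)"
      using sum.remove[OF _ bc(1), of "\<lambda>i. word [A, insert i ?D, ?D] :: 'a tensor"]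
        sum.remove[OF _ bc(2), of "\<lambda>i. word [A, insert i ?D, ?D] :: 'a tensor"]
      by (simp del: One_nat_def)
    moreover have "insert b ?D = A - {c}" "insert c ?D = A - {b}" using assms by auto
    ultimately show ?thesis by simp
  qed
  ultimately show ?thesis by simp
qed

text \<open>Induction brings the repeated letter to the front of the tail, and
  \<open>word_square_shift\<close> replaces the doubled \<open>A - {b}\<close> after
  \<open>A\<close> by a doubled \<open>A\<close>.\<close>

lemma chain_square_shift:
  assumes "A \<subseteq> {1..n}" "distinct bs" "set bs \<subset> A"
  shows "eq_up_to_sign n (word (chain A bs @ [A - set bs])) (word (A # chain A bs) :: 'a::field tensor)"
  using assms
proof (induction bs arbitrary: A)
  case Nil
  then show ?case by (simp add: eq_up_to_sign_refl)
next
  case (Cons b bs)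
  let ?D = "A - {b}"
  have D: "?D \<subseteq> {1..n}" "set bs \<subset> ?D" and A: "A \<in> letters n" and b: "b \<in> A"
    using Cons.prems by (auto simp: letters_def)
  obtain w where w: "chain ?D bs = ?D # w" using chain_eq_Cons by blast
  have w_letters: "w \<in> lists (letters n)"
    using chain_in_lists[OF D(1) _ D(2)] Cons.prems(2) by (simp add: w)
  have "eq_up_to_sign n (word (chain ?D bs @ [?D - set bs])) (word (?D # chain ?D bs) :: 'a tensor)"
    using Cons.prems D by (intro Cons.IH) auto
  from eq_up_to_sign_mult[OF this, of "[A]" "[]"] A
  have "eq_up_to_sign n (word (A # chain ?D bs @ [?D - set bs])) (word (A # ?D # chain ?D bs) :: 'a tensor)"
    by (simp add: word_mult)
  moreover have "eq_up_to_sign n (word (A # ?D # chain ?D bs)) (word (A # A # chain ?D bs) :: 'a tensor)"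
  proof -
    have "eq_up_to_sign n (word [A, ?D, ?D]) (word [A, A, ?D] :: 'a tensor)"
      using word_square_shift[OF A b, where 'a = 'a] D(2) unfolding eq_up_to_sign_def
      by (auto simp: add.commute)
    from eq_up_to_sign_mult[OF this, of "[]" w] w_letters show ?thesis by (simp add: word_mult w)
  qed
  ultimately have "eq_up_to_sign n (word (A # chain ?D bs @ [?D - set bs])) (word (A # A # chain ?D bs) :: 'a tensor)"
    by (rule eq_up_to_sign_trans)
  moreover have "?D - set bs = A - set (b # bs)" by auto
  ultimately show ?case by simp
qed

text \<open>Exchanging two successive removals costs only a sign by \<open>word_swap\<close>.
  Induction on the length reorders the tails.\<close>

lemma chain_permute:
  assumes "A \<subseteq> {1..n}" "distinct bs" "set bs \<subset> A" "mset bs = mset cs"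
  shows "eq_up_to_sign n (word (chain A bs)) (word (chain A cs) :: 'a::field tensor)"
  using assms
proof (induction "length bs" arbitrary: A bs cs rule: less_induct)
  case less
  have A: "A \<in> letters n" using less.prems by (auto simp: letters_def)
  have prepend: "eq_up_to_sign n (word (chain A (b # bs'))) (word (chain A (b # cs')) :: 'a tensor)"
    if "length bs' < length bs" "b \<in> A" "distinct bs'" "set bs' \<subset> A - {b}" "mset bs' = mset cs'" for b bs' cs'
  proof -
    have "eq_up_to_sign n (word (chain (A - {b}) bs')) (word (chain (A - {b}) cs') :: 'a tensor)"
      using that less.prems(1) by (intro less.hyps) auto
    from eq_up_to_sign_mult[OF this, of "[A]" "[]"] A show ?thesis by (simp add: word_mult)
  qed
  show ?case
  proof (cases bs)
    case Nil
    with less.prems show ?thesis by (simp add: eq_up_to_sign_refl)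
  next
    case (Cons b bs')
    then obtain c cs' where cs: "cs = c # cs'" using less.prems(4) by (cases cs) auto
    show ?thesis
    proof (cases "b = c")
      case True
      then show ?thesis
        using prepend[of bs' b cs'] less.prems by (auto simp: Cons cs)
    next
      case False
      \<comment> \<open>With \<open>ds\<close> the common rest, \<open>bs\<close> is brought to
        \<open>b # c # ds\<close> and \<open>cs\<close> to \<open>c # b # ds\<close>; these differ
        by one exchange at the front.\<close>
      define ds where "ds = remove1 c bs'"
      have "c \<in> set bs'" using mset_eq_setD[OF less.prems(4)] False by (auto simp: Cons cs)
      then have bs': "mset bs' = mset (c # ds)" by (simp add: ds_def)
      have cs': "mset cs' = mset (b # ds)"
        using less.prems(4) bs' by (simp add: Cons cs add_mset_commute)
      have set: "set bs' = insert c (set ds)" "distinct (c # ds)" "length bs' = Suc (length ds)"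
        using mset_eq_setD[OF bs'] mset_eq_imp_distinct_iff[OF bs'] mset_eq_length[OF bs'] less.prems(2)
        by (auto simp: Cons)
      have ds: "b \<notin> set ds" "b \<in> A" "c \<in> A" "set ds \<subset> A - {b, c}" "distinct ds" "b \<notin> set bs'"
        using less.prems(2,3) set by (auto simp: Cons)
      have D: "A - {b, c} \<subseteq> {1..n}" "A - {b, c} \<noteq> {}" using less.prems(1) ds by auto
      obtain w where w: "chain (A - {b, c}) ds = (A - {b, c}) # w" using chain_eq_Cons by blast
      have w_letters: "w \<in> lists (letters n)"
        using chain_in_lists[OF D(1) ds(5,4)] by (simp add: w)
      have eqs: "A - {b} - {c} = A - {b, c}" "A - {c} - {b} = A - {b, c}" by auto
      have "eq_up_to_sign n (word (chain A (b # bs'))) (word (chain A (b # c # ds)) :: 'a tensor)"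
        using bs' set ds less.prems by (intro prepend) (auto simp: Cons)
      moreover have "eq_up_to_sign n (word (chain A (b # c # ds))) (word (chain A (c # b # ds)) :: 'a tensor)"
      proof -
        have "eq_up_to_sign n (word [A, A - {b}, A - {b, c}]) (word [A, A - {c}, A - {b, c}] :: 'a tensor)"
          using word_swap[OF A ds(2,3) False D(2)] unfolding eq_up_to_sign_def by blast
        from eq_up_to_sign_mult[OF this, of "[]" w] w_letters show ?thesis
          by (simp add: word_mult w eqs)
      qed
      moreover have "eq_up_to_sign n (word (chain A (c # b # ds))) (word (chain A (c # cs')) :: 'a tensor)"
        using cs' set ds less.prems by (intro prepend) (auto simp: Cons)
      ultimately show ?thesis
        unfolding Cons cs by (blast intro: eq_up_to_sign_trans)
    qed
  qed
qed

section \<open>Rewriting words as combinations of the products\<close>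

text \<open>The preimage in the tensor algebra of the span of the family, so that the rewriting can
  work with representatives instead of cosets.\<close>

inductive_set chain_span :: "nat \<Rightarrow> 'a::field tensor set" for n where
  ideal: "p \<in> dual_ideal n \<Longrightarrow> p \<in> chain_span n"
| one: "1 \<in> chain_span n"
| chain: "(A, B) \<in> index_pairs n \<Longrightarrow> word (chain A (decreasing B)) \<in> chain_span n"
| add: "p \<in> chain_span n \<Longrightarrow> q \<in> chain_span n \<Longrightarrow> p + q \<in> chain_span n"
| scale: "p \<in> chain_span n \<Longrightarrow> scalar c * p \<in> chain_span n"

lemma chain_span_uminus: "p \<in> chain_span n \<Longrightarrow> - p \<in> chain_span n"
  using chain_span.scale[of p n "- 1"] by (simp add: single_uminus)

lemma chain_span_diff: "p \<in> chain_span n \<Longrightarrow> q \<in> chain_span n \<Longrightarrow> p - q \<in> chain_span n"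
  using chain_span.add[of p n "- q"] chain_span_uminus[of q n] by simp

lemma chain_span_sum: "(\<And>i. i \<in> I \<Longrightarrow> f i \<in> chain_span n) \<Longrightarrow> (\<Sum>i\<in>I. f i) \<in> chain_span n"
  by (induction I rule: infinite_finite_induct) (simp_all add: chain_span.add chain_span.ideal dual_ideal_zero)

lemma chain_span_eq_up_to_sign:
  assumes "eq_up_to_sign n x y" "y \<in> chain_span n"
  shows "x \<in> chain_span n"
proof -
  have "x = (x - y) + y" "x = (x + y) - y" by simp_all
  then show ?thesis
    using assms unfolding eq_up_to_sign_def by (metis chain_span.add chain_span_diff chain_span.ideal)
qed

lemma chain_in_chain_span_if_Min_notin:
  assumes "A \<subseteq> {1..n}" "distinct bs" "set bs \<subset> A" "Min A \<notin> set bs"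
  shows "(word (chain A bs) :: 'a::field tensor) \<in> chain_span n"
proof (rule chain_span_eq_up_to_sign)
  show "eq_up_to_sign n (word (chain A bs)) (word (chain A (decreasing (set bs))) :: 'a tensor)"
    using assms by (intro chain_permute) (simp_all flip: set_eq_iff_mset_eq_distinct)
  show "(word (chain A (decreasing (set bs))) :: 'a tensor) \<in> chain_span n"
    using assms by (intro chain_span.chain) (auto simp: index_pairs_def)
qed

text \<open>The insertion relation trades the doubled first letter for chains that start with
  \<open>insert i A\<close>. These are left as an assumption, to be met by an induction hypothesis
  in \<open>chain_in_chain_span\<close> and by that lemma itself afterwards.\<close>

lemma square_in_chain_span:
  assumes "A \<subseteq> {1..n}" "distinct bs" "set bs \<subset> A"
    and "\<And>i. i \<in> {1..n} - A \<Longrightarrow> (word (chain (insert i A) (i # bs)) :: 'a::field tensor) \<in> chain_span n"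
  shows "(word (A # chain A bs) :: 'a::field tensor) \<in> chain_span n"
proof -
  have A: "A \<in> letters n" using assms by (auto simp: letters_def)
  obtain w where w: "chain A bs = A # w" using chain_eq_Cons by blast
  have w_letters: "w \<in> lists (letters n)" using chain_in_lists[OF assms(1-3)] by (simp add: w)
  let ?s = "\<Sum>i\<in>{1..n} - A. word (insert i A # A # w) :: 'a tensor"
  have "(word [A, A] + (\<Sum>i\<in>{1..n} - A. word [insert i A, A])) * word w \<in> (dual_ideal n :: 'a tensor set)"
    using A w_letters by (intro dual_ideal_mult_right word_sum_insert_in_dual_ideal)
  then have "word (A # chain A bs) + ?s \<in> chain_span n"
    by (intro chain_span.ideal) (simp add: distrib_right sum_distrib_right word_mult w)
  moreover have "?s \<in> chain_span n"
  proof (rule chain_span_sum)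
    fix i assume i: "i \<in> {1..n} - A"
    then have "insert i A - {i} = A" by auto
    with assms(4)[OF i] show "(word (insert i A # A # w) :: 'a tensor) \<in> chain_span n" by (simp add: w)
  qed
  ultimately have "word (A # chain A bs) + ?s - ?s \<in> chain_span n" by (rule chain_span_diff)
  then show ?thesis by simp
qed

text \<open>The induction goes from large sets \<open>A\<close> to small ones, because eliminating a
  square enlarges the first letter.\<close>

lemma chain_in_chain_span:
  assumes "A \<subseteq> {1..n}" "distinct bs" "set bs \<subset> A"
  shows "(word (chain A bs) :: 'a::field tensor) \<in> chain_span n"
  using assms
proof (induction "n - card A" arbitrary: A bs rule: less_induct)
  case less
  have fin: "finite A" using less.prems(1) by (rule finite_subset) simp
  show ?case
  proof (cases "Min A \<in> set bs")
    case False
    then show ?thesis using less.prems by (intro chain_in_chain_span_if_Min_notin)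
  next
    case True
    define m where "m = Min A"
    \<comment> \<open>Once the removal of \<open>m\<close> is postponed to the end, the preceding
      letter is \<open>D\<close>, and the relation for \<open>[D, D]\<close> expresses this removal
      through the removals of other elements.\<close>
    define cs where "cs = remove1 m bs"
    have m: "m \<in> set bs" using True by (simp add: m_def)
    have cs: "distinct cs" "set cs = set bs - {m}" using less.prems(2) by (simp_all add: cs_def)
    define D where "D = A - set cs"
    have D: "D \<in> letters n" "m \<in> D" "set bs - {m} \<subset> A"
      using less.prems cs m by (auto simp: D_def letters_def)
    obtain ws where ws: "chain A cs = ws @ [D]" using chain_last unfolding D_def by blast
    have ws_letters: "ws \<in> lists (letters n)"
      using chain_in_lists[OF less.prems(1) cs(1)] D(3) by (simp add: ws cs(2))
    have step: "chain A (cs @ [i]) = ws @ [D, D - {i}]" for i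
      by (simp add: chain_snoc ws D_def)
    \<comment> \<open>An element of \<open>A\<close> outside \<open>set bs\<close> stays in
      \<open>D\<close> together with \<open>m\<close>, so \<open>D\<close> has at least two
      elements, as \<open>word_sum_remove_in_dual_ideal\<close> demands.\<close>
    have "D - {i} \<noteq> {}" if "i \<in> D" for i
    proof -
      obtain k where "k \<in> A - set bs" using less.prems(3) by blast
      then have "k \<in> D" "k \<noteq> m" using m by (auto simp: D_def cs(2))
      then show ?thesis using D(2) by auto
    qed
    then have "word ws * (word [D, D] + (\<Sum>i\<in>D. word [D, D - {i}])) \<in> (dual_ideal n :: 'a tensor set)"
      using D(1) ws_letters by (intro dual_ideal_mult_left word_sum_remove_in_dual_ideal)
    then have sum: "word (chain A cs @ [D]) + (\<Sum>i\<in>D. word (chain A (cs @ [i]))) \<in> (chain_span n :: 'a tensor set)"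
      by (intro chain_span.ideal) (simp add: distrib_left sum_distrib_left word_mult ws step)
    \<comment> \<open>The doubled last letter moves to the front, where it becomes a combination of
      chains starting with \<open>insert i A\<close>, covered by induction.\<close>
    have square: "word (chain A cs @ [D]) \<in> (chain_span n :: 'a tensor set)"
    proof (rule chain_span_eq_up_to_sign)
      show "eq_up_to_sign n (word (chain A cs @ [D])) (word (A # chain A cs) :: 'a tensor)"
        unfolding D_def using less.prems(1) cs D(3) by (intro chain_square_shift) auto
      show "(word (A # chain A cs) :: 'a tensor) \<in> chain_span n"
      proof (rule square_in_chain_span)
        fix i assume i: "i \<in> {1..n} - A"
        then have "card (insert i A) \<le> card {1..n}"
          using less.prems(1) by (intro card_mono) auto
        then have "n - card (insert i A) < n - card A" using i fin by simp
        then show "(word (chain (insert i A) (i # cs)) :: 'a tensor) \<in> chain_span n"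
          by (rule less.hyps) (use i less.prems cs D(3) in auto)
      qed (use less.prems(1) cs D(3) in auto)
    qed
    \<comment> \<open>These summands never remove \<open>m\<close>, so only the order of their
      removals has to be changed.\<close>
    have "(\<Sum>i\<in>D - {m}. word (chain A (cs @ [i]))) \<in> (chain_span n :: 'a tensor set)"
    proof (rule chain_span_sum)
      fix i assume i: "i \<in> D - {m}"
      have "m \<in> A" "m \<notin> set (cs @ [i])" "set (cs @ [i]) \<subseteq> A"
        using i D(2,3) cs(2) by (auto simp: D_def)
      moreover from this have "set (cs @ [i]) \<subset> A" by blast
      ultimately show "word (chain A (cs @ [i])) \<in> (chain_span n :: 'a tensor set)"
        using less.prems(1) cs(1) i
        by (intro chain_in_chain_span_if_Min_notin) (auto simp: D_def simp flip: m_def)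
    qed
    from chain_span_diff[OF chain_span_diff[OF sum square] this]
    have "word (chain A (cs @ [m])) \<in> (chain_span n :: 'a tensor set)"
      by (simp add: sum.remove[OF letters_finite[OF D(1)] D(2)])
    moreover have "mset bs = mset (cs @ [m])" using m by (simp add: cs_def)
    then have "eq_up_to_sign n (word (chain A bs)) (word (chain A (cs @ [m])) :: 'a tensor)"
      by (rule chain_permute[OF less.prems])
    ultimately show ?thesis by (rule chain_span_eq_up_to_sign[rotated])
  qed
qed

text \<open>Starting from the unit, multiplication by letters reaches every word. Before a chain of
  \<open>A\<close>, the letter \<open>C = A\<close> makes a square, a letter with
  \<open>A = C - {i}\<close> extends the chain, and any other letter gives an element of the
  ideal.\<close>

lemma chain_span_mult_letter:
  assumes "p \<in> chain_span n" "C \<in> letters n"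
  shows "word [C] * (p :: 'a::field tensor) \<in> chain_span n"
  using assms(1)
proof induction
  case (ideal p)
  then show ?case using assms(2) by (intro chain_span.ideal dual_ideal_mult_left) auto
next
  case one
  show ?case using chain_in_chain_span[of C n "[]", where 'a = 'a] assms(2) by (auto simp: letters_def)
next
  case (chain A B)
  let ?bs = "decreasing B"
  note AB = index_pairsD[OF chain]
  have "B \<noteq> A" using AB(4,7) by blast
  then have bs: "distinct ?bs" "set ?bs \<subset> A" using AB by auto
  have A: "A \<in> letters n" using AB by (auto simp: letters_def)
  obtain w where w: "chain A ?bs = A # w" using chain_eq_Cons by blast
  consider "C = A" | i where "i \<in> C" "A = C - {i}" | "A \<noteq> C" "\<And>i. i \<in> C \<Longrightarrow> A \<noteq> C - {i}" by blast
  then show ?case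
  proof cases
    case 1
    have "(word (A # chain A ?bs) :: 'a tensor) \<in> chain_span n"
    proof (rule square_in_chain_span)
      fix i assume "i \<in> {1..n} - A"
      then show "(word (chain (insert i A) (i # ?bs)) :: 'a tensor) \<in> chain_span n"
        using AB(2) bs by (intro chain_in_chain_span) auto
    qed (use AB bs in auto)
    then show ?thesis by (simp add: 1 word_mult)
  next
    case 2
    have "(word (chain C (i # ?bs)) :: 'a tensor) \<in> chain_span n"
      using 2 bs assms(2) by (intro chain_in_chain_span) (auto simp: letters_def)
    then show ?thesis by (simp add: 2(2) word_mult)
  next
    case 3
    have "w \<in> lists (letters n)" using chain_in_lists[OF AB(2) bs] by (simp add: w)
    then have "word [C, A] * word w \<in> (chain_span n :: 'a tensor set)"
      using 3 A assms(2) by (intro chain_span.ideal dual_ideal_mult_right word_in_dual_ideal) auto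
    then show ?thesis by (simp add: w word_mult)
  qed
next
  case (add p q)
  then show ?case by (simp add: distrib_left chain_span.add)
next
  case (scale p c)
  have "word [C] * (scalar c * p) = scalar c * (word [C] * p)"
    unfolding mult.assoc[symmetric] scalar_commute[of c "word [C]"] ..
  with scale show ?case by (simp add: chain_span.scale)
qed

lemma carrier_subset_chain_span:
  assumes "p \<in> carrier (tensor_algebra n)"
  shows "(p :: 'a::field tensor) \<in> chain_span n"
proof -
  have word: "(word w :: 'a tensor) \<in> chain_span n" if "w \<in> lists (letters n)" for w
    using that
  proof (induction w)
    case (Cons C w)
    then show ?case using chain_span_mult_letter[of "word w" n C] by (simp add: word_mult)
  qed (simp add: word_Nil chain_span.one)
  have "Poly_Mapping.single w (Poly_Mapping.lookup p w) \<in> chain_span n" if "w \<in> Poly_Mapping.keys p" for w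
    using chain_span.scale[OF word, of w "Poly_Mapping.lookup p w"] that assms by (auto simp: scalar_mult_word)
  then show ?thesis
    by (subst tensor_expansion) (rule chain_span_sum)
qed

section \<open>The basis\<close>

text \<open>Matches the recursive form of a chain with the way \<open>S_prod\<close> lists its
  factors.\<close>

lemma chain_eq_map: "chain A bs = map (\<lambda>k. A - set (take k bs)) [0..<Suc (length bs)]"
proof (induction bs arbitrary: A)
  case (Cons b bs)
  have "A - {b} - set (take k bs) = A - set (take (Suc k) (b # bs))" for k by auto
  then show ?case
    unfolding chain.simps Cons.IH length_Cons
    by (subst (2) upt_conv_Cons) (simp_all add: map_Suc_upt[symmetric] del: upt_Suc)
qed simp

context
  fixes n :: nat
begin

abbreviation proj :: "'a::field tensor \<Rightarrow> 'a tensor set" where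
  "proj p \<equiv> dual_ideal n +>\<^bsub>tensor_algebra n\<^esub> p"

interpretation T: ring "tensor_algebra n :: ('a::field, 'a tensor) module"
  by (rule ring_tensor_algebra)

interpretation J: ideal "dual_ideal n :: 'a::field tensor set" "tensor_algebra n"
  by (rule ideal_dual_ideal)

interpretation V: vectorspace "class_ring :: 'a::field ring" "dual_algebra n :: ('a, 'a tensor set) module"
  by (rule vectorspace_dual_algebra)

lemma zero_dual_algebra: "\<zero>\<^bsub>dual_algebra n\<^esub> = (dual_ideal n :: 'a::field tensor set)"
  by (simp add: dual_algebra_def FactRing_def ring.defs)

lemma proj_eq_zero_iff:
  assumes "p \<in> carrier (tensor_algebra n)"
  shows "proj p = \<zero>\<^bsub>dual_algebra n\<^esub> \<longleftrightarrow> (p :: 'a::field tensor) \<in> dual_ideal n"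
  unfolding zero_dual_algebra
  using J.a_rcos_self[OF assms] J.a_rcos_const[of p] by metis

lemma proj_eq_imp_diff:
  assumes "p \<in> carrier (tensor_algebra n)" "q \<in> carrier (tensor_algebra n)" "proj p = proj q"
  shows "(p - q :: 'a::field tensor) \<in> dual_ideal n"
proof -
  have "p \<in> proj q" using J.a_rcos_self[OF assms(1)] assms(3) by simp
  then obtain h where "h \<in> dual_ideal n" "p = h + q" by (auto simp: a_r_coset_def')
  then show ?thesis by simp
qed

lemma proj_closed:
  "p \<in> carrier (tensor_algebra n) \<Longrightarrow> proj (p :: 'a::field tensor) \<in> carrier (dual_algebra n)"
  unfolding dual_algebra_simps(1) by blast

lemma finsum_proj:
  assumes "finite I" "\<And>i. i \<in> I \<Longrightarrow> f i \<in> carrier (tensor_algebra n)"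
  shows "finsum (dual_algebra n) (\<lambda>i. proj (f i)) I = proj (\<Sum>i\<in>I. f i :: 'a::field tensor)
    \<and> (\<Sum>i\<in>I. f i) \<in> carrier (tensor_algebra n)"
  using assms
proof (induction I)
  case empty
  have "proj (0 :: 'a tensor) = \<zero>\<^bsub>dual_algebra n\<^esub>"
    by (subst proj_eq_zero_iff) (simp_all add: dual_ideal_zero)
  then show ?case by simp
next
  case (insert i I)
  then have "f i + sum f I \<in> carrier (tensor_algebra n)"
    using T.a_closed[of "f i" "sum f I"] by simp
  with insert show ?case
    using dual_algebra_simps(3)[of "f i" n "sum f I"]
    by (subst V.finsum_insert) (auto simp: Pi_iff proj_closed simp del: tensor_algebra_simps(1))
qed

lemma foldr_s_gen:
  assumes "ws \<in> lists (letters n)"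
  shows "foldr (\<otimes>\<^bsub>dual_algebra n\<^esub>) (map (s_gen n) ws) \<one>\<^bsub>dual_algebra n\<^esub> = proj (word ws :: 'a::field tensor)"
  using assms
proof (induction ws)
  case Nil
  show ?case by (simp add: dual_algebra_simps(2) word_Nil)
next
  case (Cons A ws)
  then show ?case
    using dual_algebra_simps(4)[of "word [A] :: 'a tensor" n "word ws"]
    by (simp add: s_gen_def v_dual_def word_mult)
qed

lemma index_pairs_chain_in_carrier:
  assumes "(A, B) \<in> index_pairs n"
  shows "word (chain A (decreasing B)) \<in> carrier (tensor_algebra n :: ('a::field, 'a tensor) module)"
    and "S_prod n A B = proj (word (chain A (decreasing B)) :: 'a::field tensor)"
proof -
  note AB = index_pairsD[OF assms]
  have "B \<noteq> A" using AB(4,7) by blast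
  then have "chain A (decreasing B) \<in> lists (letters n)"
    using AB by (intro chain_in_lists) auto
  then show "word (chain A (decreasing B)) \<in> carrier (tensor_algebra n :: ('a, 'a tensor) module)"
    "S_prod n A B = proj (word (chain A (decreasing B)) :: 'a tensor)"
    using foldr_s_gen[of "chain A (decreasing B)", where 'a = 'a]
    by (simp, simp add: S_prod_def Let_def chain_eq_map comp_def del: upt_Suc)
qed

definition monomial_family :: "'a::field tensor set set" where
  "monomial_family = insert \<one>\<^bsub>dual_algebra n\<^esub> ((\<lambda>(A, B). S_prod n A B) ` index_pairs n)"

lemma one_eq_proj: "\<one>\<^bsub>dual_algebra n\<^esub> = proj (1 :: 'a::field tensor)"
  by (simp add: dual_algebra_simps(2))

lemma one_in_carrier: "(1 :: 'a::field tensor) \<in> carrier (tensor_algebra n)"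
  using T.one_closed by simp

lemma monomial_family_closed: "(monomial_family :: 'a::field tensor set set) \<subseteq> carrier (dual_algebra n)"
proof -
  have "S_prod n A B \<in> carrier (dual_algebra n :: ('a, 'a tensor set) module)" if "(A, B) \<in> index_pairs n" for A B
    using index_pairs_chain_in_carrier[OF that, where 'a = 'a] by (simp only: proj_closed)
  moreover have "\<one>\<^bsub>dual_algebra n\<^esub> \<in> carrier (dual_algebra n :: ('a, 'a tensor set) module)"
    unfolding one_eq_proj by (rule proj_closed[OF one_in_carrier])
  ultimately show ?thesis by (auto simp: monomial_family_def)
qed

lemma proj_chain_span:
  assumes "p \<in> chain_span n"
  shows "p \<in> carrier (tensor_algebra n) \<and> proj (p :: 'a::field tensor) \<in> V.span monomial_family"
  using assms
proof induction
  case (ideal p)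
  then have p: "p \<in> carrier (tensor_algebra n)" by (rule J.a_Hcarr)
  with ideal have "proj p = \<zero>\<^bsub>dual_algebra n\<^esub>" by (simp only: proj_eq_zero_iff)
  with p show ?case
    using LinearCombinations.submodule.zero_closed[OF V.span_is_submodule[OF monomial_family_closed]]
    by (simp del: tensor_algebra_simps)
next
  case one
  have "proj (1 :: 'a tensor) \<in> monomial_family" by (simp add: monomial_family_def one_eq_proj)
  then show ?case
    using V.in_own_span[OF monomial_family_closed] one_in_carrier by blast
next
  case (chain A B)
  have "S_prod n A B \<in> (monomial_family :: 'a tensor set set)"
    using chain by (auto simp: monomial_family_def)
  then show ?case
    using V.in_own_span[OF monomial_family_closed] index_pairs_chain_in_carrier[OF chain, where 'a = 'a]
    by (simp only:) blast
next
  case (add p q)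
  then have "proj (p + q) = proj p \<oplus>\<^bsub>dual_algebra n\<^esub> proj q"
    by (subst dual_algebra_simps(3)) simp_all
  with add show ?case
    using LinearCombinations.submodule.m_closed[OF V.span_is_submodule[OF monomial_family_closed], of "proj p" "proj q"]
      T.a_closed[of p q] by simp
next
  case (scale p c)
  then have "proj (scalar c * p) = c \<odot>\<^bsub>dual_algebra n\<^esub> proj p"
    by (subst dual_algebra_simps(5)) simp_all
  with scale show ?case
    using LinearCombinations.submodule.smult_closed[OF V.span_is_submodule[OF monomial_family_closed], of c "proj p"]
      keys_scalar_mult[of c p] by auto
qed

lemma span_monomial_family: "V.span monomial_family = carrier (dual_algebra n :: ('a::field, 'a tensor set) module)"
proof
  show "V.span monomial_family \<subseteq> carrier (dual_algebra n :: ('a, 'a tensor set) module)"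
    by (rule V.span_is_subset2[OF monomial_family_closed])
  show "carrier (dual_algebra n :: ('a, 'a tensor set) module) \<subseteq> V.span monomial_family"
    unfolding dual_algebra_simps(1) using proj_chain_span[OF carrier_subset_chain_span] by blast
qed

section \<open>Distinctness and independence in the quotient\<close>

lemma sum_scalar_of_bool:
  assumes "finite I" "z \<in> I"
  shows "(\<Sum>x\<in>I. scalar (of_bool (x = z)) * f x) = (f z :: 'a::field tensor)"
proof -
  have "(\<Sum>x\<in>I. scalar (of_bool (x = z)) * f x) = (\<Sum>x\<in>I. if x = z then f z else 0)"
    by (intro sum.cong) auto
  with assms show ?thesis by simp
qed

text \<open>Equal products with different indices would give a combination in the ideal with
  coefficients 1 and -1, contrary to \<open>chain_combination_in_dual_ideal\<close>.\<close>

lemma inj_on_S_prod: "inj_on (\<lambda>(A, B). S_prod n A B :: 'a::field tensor set) (index_pairs n)"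
proof (rule inj_onI, rule ccontr)
  fix z z' assume z: "z \<in> index_pairs n" "z' \<in> index_pairs n" "z \<noteq> z'"
    and eq: "(case z of (A, B) \<Rightarrow> S_prod n A B) = (case z' of (A, B) \<Rightarrow> (S_prod n A B :: 'a tensor set))"
  define f :: "nat set \<times> nat set \<Rightarrow> 'a tensor" where "f = (\<lambda>(A, B). word (chain A (decreasing B)))"
  define c :: "nat set \<times> nat set \<Rightarrow> 'a" where "c x = of_bool (x = z) - of_bool (x = z')" for x
  have "f x \<in> carrier (tensor_algebra n)" "(case x of (A, B) \<Rightarrow> S_prod n A B) = proj (f x)"
    if "x \<in> index_pairs n" for x
    using index_pairs_chain_in_carrier[of "fst x" "snd x", where 'a = 'a] that
    by (auto simp: f_def split_def simp del: tensor_algebra_simps)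
  with z eq have "f z - f z' \<in> dual_ideal n"
    by (intro proj_eq_imp_diff) simp_all
  also have "f z - f z' = (\<Sum>x\<in>index_pairs n. scalar (c x) * f x)"
    unfolding c_def single_diff left_diff_distrib sum_subtractf
    by (simp only: sum_scalar_of_bool[OF finite_index_pairs] z)
  finally have comb: "scalar 0 + (\<Sum>(A, B)\<in>index_pairs n. scalar (c (A, B)) * word (chain A (decreasing B))) \<in> dual_ideal n"
    by (simp add: f_def split_def)
  have "c z = 0"
    using chain_combination_in_dual_ideal(2)[OF comb] z(1) by blast
  with z(3) show False by (simp add: c_def)
qed

text \<open>Equality with a product would give a combination in the ideal with scalar term
  1.\<close>

lemma one_notin_S_prod: "\<one>\<^bsub>dual_algebra n\<^esub> \<notin> (\<lambda>(A, B). S_prod n A B :: 'a::field tensor set) ` index_pairs n"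
proof
  assume "\<one>\<^bsub>dual_algebra n\<^esub> \<in> (\<lambda>(A, B). S_prod n A B :: 'a tensor set) ` index_pairs n"
  then obtain A B where z: "(A, B) \<in> index_pairs n" "\<one>\<^bsub>dual_algebra n\<^esub> = (S_prod n A B :: 'a tensor set)"
    by auto
  define f :: "nat set \<times> nat set \<Rightarrow> 'a tensor" where "f = (\<lambda>(A, B). word (chain A (decreasing B)))"
  define c :: "nat set \<times> nat set \<Rightarrow> 'a" where "c x = - of_bool (x = (A, B))" for x
  have "1 - f (A, B) \<in> dual_ideal n"
    using index_pairs_chain_in_carrier[OF z(1), where 'a = 'a] z(2) one_in_carrier
    by (intro proj_eq_imp_diff) (simp_all add: one_eq_proj f_def del: tensor_algebra_simps)
  also have "1 - f (A, B) = scalar 1 + (\<Sum>x\<in>index_pairs n. scalar (c x) * f x)"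
    unfolding c_def single_uminus minus_mult_left[symmetric] sum_negf
    by (simp add: sum_scalar_of_bool[OF finite_index_pairs z(1)] del: of_bool_eq_iff)
  finally have comb: "scalar 1 + (\<Sum>(A, B)\<in>index_pairs n. scalar (c (A, B)) * word (chain A (decreasing B))) \<in> dual_ideal n"
    by (simp add: f_def split_def)
  show False
    using chain_combination_in_dual_ideal(1)[OF comb] by simp
qed

text \<open>Independence concerns a set of cosets. \<open>inj_on_S_prod\<close> and
  \<open>one_notin_S_prod\<close> turn the sum over this set into the unit term plus a sum over
  index pairs, which lifts to a combination of chains in the tensor algebra.\<close>

lemma lin_indpt_monomial_family: "V.lin_indpt (monomial_family :: 'a::field tensor set set)"
proof (rule V.finite_lin_indpt2[OF _ monomial_family_closed])
  let ?S = "(\<lambda>(A, B). S_prod n A B :: 'a tensor set)"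
  show "finite (monomial_family :: 'a tensor set set)"
    by (simp add: monomial_family_def finite_index_pairs)
  fix a :: "'a tensor set \<Rightarrow> 'a"
  assume a: "a \<in> monomial_family \<rightarrow> carrier class_ring"
    and zero: "V.lincomb a monomial_family = \<zero>\<^bsub>dual_algebra n\<^esub>"
  define f :: "nat set \<times> nat set \<Rightarrow> 'a tensor" where "f = (\<lambda>(A, B). word (chain A (decreasing B)))"
  define g where "g z = scalar (a (?S z)) * f z" for z
  have f: "f z \<in> carrier (tensor_algebra n)" "?S z = proj (f z)" if "z \<in> index_pairs n" for z
    using index_pairs_chain_in_carrier[of "fst z" "snd z", where 'a = 'a] that
    by (auto simp: f_def split_def simp del: tensor_algebra_simps)
  have g: "g z \<in> carrier (tensor_algebra n)" "a (?S z) \<odot>\<^bsub>dual_algebra n\<^esub> ?S z = proj (g z)"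
    if "z \<in> index_pairs n" for z
  proof -
    show "g z \<in> carrier (tensor_algebra n)"
      using f(1)[OF that] keys_scalar_mult[of "a (?S z)" "f z"] by (auto simp: g_def)
    show "a (?S z) \<odot>\<^bsub>dual_algebra n\<^esub> ?S z = proj (g z)"
      using dual_algebra_simps(5)[OF f(1)[OF that], of "a (?S z)"] f(2)[OF that] by (simp add: g_def)
  qed
  have summand_closed: "a (?S z) \<odot>\<^bsub>dual_algebra n\<^esub> ?S z \<in> carrier (dual_algebra n)"
    if "z \<in> index_pairs n" for z
    unfolding g(2)[OF that] by (rule proj_closed[OF g(1)[OF that]])
  have one: "scalar (a \<one>\<^bsub>dual_algebra n\<^esub>) \<in> carrier (tensor_algebra n :: ('a, 'a tensor) module)"
    "a \<one>\<^bsub>dual_algebra n\<^esub> \<odot>\<^bsub>dual_algebra n\<^esub> \<one>\<^bsub>dual_algebra n\<^esub> = proj (scalar (a \<one>\<^bsub>dual_algebra n\<^esub>))"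
    using dual_algebra_simps(5)[OF one_in_carrier, of "a \<one>\<^bsub>dual_algebra n\<^esub>"]
    by (simp_all add: one_eq_proj zero_list_def)
  note sum = finsum_proj[of "index_pairs n" g, OF finite_index_pairs g(1)]
  have "V.lincomb a monomial_family = a \<one>\<^bsub>dual_algebra n\<^esub> \<odot>\<^bsub>dual_algebra n\<^esub> \<one>\<^bsub>dual_algebra n\<^esub>
      \<oplus>\<^bsub>dual_algebra n\<^esub> finsum (dual_algebra n) (\<lambda>v. a v \<odot>\<^bsub>dual_algebra n\<^esub> v) (?S ` index_pairs n)"
    unfolding V.lincomb_def monomial_family_def
  proof (rule V.finsum_insert)
    show "(\<lambda>v. a v \<odot>\<^bsub>dual_algebra n\<^esub> v) \<in> ?S ` index_pairs n \<rightarrow> carrier (dual_algebra n)"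
      by (intro Pi_I, elim imageE) (simp only: summand_closed)
    show "a \<one>\<^bsub>dual_algebra n\<^esub> \<odot>\<^bsub>dual_algebra n\<^esub> \<one>\<^bsub>dual_algebra n\<^esub> \<in> carrier (dual_algebra n)"
      unfolding one(2) by (rule proj_closed[OF one(1)])
  qed (simp_all add: finite_index_pairs one_notin_S_prod)
  also have "finsum (dual_algebra n) (\<lambda>v. a v \<odot>\<^bsub>dual_algebra n\<^esub> v) (?S ` index_pairs n) =
      finsum (dual_algebra n) (\<lambda>z. a (?S z) \<odot>\<^bsub>dual_algebra n\<^esub> ?S z) (index_pairs n)"
    by (rule V.finsum_reindex[OF _ inj_on_S_prod], intro Pi_I, elim imageE) (simp only: summand_closed)
  also have "\<dots> = finsum (dual_algebra n) (\<lambda>z. proj (g z)) (index_pairs n)"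
    by (rule V.finsum_cong'[OF refl], intro Pi_I, rule proj_closed[OF g(1)]) (simp_all only: g(2))
  also have "\<dots> = proj (\<Sum>z\<in>index_pairs n. g z)" using sum by blast
  also have "a \<one>\<^bsub>dual_algebra n\<^esub> \<odot>\<^bsub>dual_algebra n\<^esub> \<one>\<^bsub>dual_algebra n\<^esub> \<oplus>\<^bsub>dual_algebra n\<^esub> proj (\<Sum>z\<in>index_pairs n. g z) =
      proj (scalar (a \<one>\<^bsub>dual_algebra n\<^esub>) + (\<Sum>z\<in>index_pairs n. g z))"
    unfolding one(2) using dual_algebra_simps(3)[OF one(1), of "\<Sum>z\<in>index_pairs n. g z"] sum by simp
  finally have "proj (scalar (a \<one>\<^bsub>dual_algebra n\<^esub>) + (\<Sum>z\<in>index_pairs n. g z)) = \<zero>\<^bsub>dual_algebra n\<^esub>"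
    using zero by simp
  moreover have "scalar (a \<one>\<^bsub>dual_algebra n\<^esub>) + (\<Sum>z\<in>index_pairs n. g z) \<in> carrier (tensor_algebra n)"
    using T.a_closed[OF one(1), of "\<Sum>z\<in>index_pairs n. g z"] sum by simp
  ultimately have "scalar (a \<one>\<^bsub>dual_algebra n\<^esub>) + (\<Sum>z\<in>index_pairs n. g z) \<in> dual_ideal n"
    by (simp only: proj_eq_zero_iff)
  then have comb: "scalar (a \<one>\<^bsub>dual_algebra n\<^esub>) + (\<Sum>(A, B)\<in>index_pairs n.
      scalar ((a \<circ> ?S) (A, B)) * word (chain A (decreasing B))) \<in> dual_ideal n"
    by (simp add: g_def f_def split_def)
  show "\<forall>v\<in>monomial_family. a v = \<zero>\<^bsub>class_ring\<^esub>"
    using chain_combination_in_dual_ideal[OF comb] by (auto simp: monomial_family_def)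
qed

end

theorem proposition6p4:
  fixes n :: nat
  assumes "n \<ge> 1"
  shows "inj_on (\<lambda>(A, B). S_prod n A B :: 'a::field tensor set) (index_pairs n)
    \<and> \<one>\<^bsub>dual_algebra n\<^esub> \<notin> (\<lambda>(A, B). S_prod n A B :: 'a tensor set) ` index_pairs n
    \<and> vectorspace.basis class_ring (dual_algebra n :: ('a, 'a tensor set) module)
        (insert \<one>\<^bsub>dual_algebra n\<^esub> ((\<lambda>(A, B). S_prod n A B) ` index_pairs n))"
proof -
  interpret V: vectorspace "class_ring :: 'a ring" "dual_algebra n :: ('a, 'a tensor set) module"
    by (rule vectorspace_dual_algebra)
  have "V.basis (monomial_family n)"
    unfolding V.basis_def
    using lin_indpt_monomial_family span_monomial_family monomial_family_closed by blast
  then show ?thesis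
    unfolding monomial_family_def by (intro conjI inj_on_S_prod one_notin_S_prod)
qed

end
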